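(* Let $d\geq 3$ be fixed and let $\alpha>\frac{1}{d}$ be fixed. If $G$ is an $(n,d,\lambda)$-graph satisfying $\lambda\leq 2\sqrt{d-1}+\frac{1}{40}$ and $\rho(G,d+29)\leq 1$, and $\widehat{G}$ is the random graph obtained from $G$ by deleting every vertex independently with probability $p=n^{-\alpha}$, then w.h.p. $\widehat{G}$ is connected.
   Context: Graphs are finite and simple. For a $d$-regular graph $G$ on $n$ vertices let $d=\lambda_0\ge\lambda_1\ge\dots\ge\lambda_{n-1}$ be the eigenvalues of its adjacency matrix, and $\lambda(G)=\max\{|\lambda_1|,|\lambda_{n-1}|\}$. An $(n,d,\lambda)$-graph is a $d$-regular graph $G$ on $n$ vertices with $\lambda(G)=\lambda$. For a graph $G=(V,E)$ and a positive number $M$, $\rho(G,M)=\max\left\{\frac{e(U)}{|U|}: \emptyset\neq U\subseteq V,\ |U|\le M\right\}$, where $e(U)$ is the number of edges of $G$ with both endpoints in $U$. Deletion process: each vertex of $G$ is deleted independently with probability $n^{-\alpha}$; $\widehat{G}$ is the subgraph of $G$ induced by the non-deleted vertices. Asymptotics are as $n\to\infty$: the statement is about every family $\{G_n\}$ of graphs ($G_n$ on $n$ vertices) satisfying the hypotheses with $\alpha,d$ fixed, and an event holds w.h.p. if its probability tends to $1$ as $n\to\infty$. *)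

theory Defs
  imports
    "HOL-Probability.Probability"
    "Graph_Theory.Pair_Digraph"
    "Graph_Theory.Digraph_Component"
    "Jordan_Normal_Form.Char_Poly"
begin

text \<open>
  A finite simple graph is a \<open>pair_graph\<close>: a finite, loop-free digraph without parallel arcs whose
  arc relation is symmetric, so every undirected edge $\{u,v\}$ is the pair of arcs $(u,v)$, $(v,u)$.
\<close>

definition regular_graph :: "nat \<Rightarrow> 'a pair_pre_digraph \<Rightarrow> bool" where
  "regular_graph d G \<longleftrightarrow> pair_graph G \<and> (\<forall>v\<in>pverts G. out_degree G v = d)"

definition vertex_enum :: "'a pair_pre_digraph \<Rightarrow> 'a list" where
  "vertex_enum G = (SOME vs. distinct vs \<and> set vs = pverts G)"

text \<open>
  Another choice of enumeration conjugates the matrix by a permutation matrix and hence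
  does not change its eigenvalues.
\<close>

definition adjacency_matrix :: "'a pair_pre_digraph \<Rightarrow> real mat" where
  "adjacency_matrix G =
     (let vs = vertex_enum G; n = length vs
      in mat n n (\<lambda>(i, j). if (vs ! i, vs ! j) \<in> parcs G then 1 else 0))"

text \<open>
  The eigenvalues in non-increasing order, repeated according to multiplicity. The adjacency
  matrix is real symmetric, so its characteristic polynomial splits over the reals and
  the list has one entry per vertex.
\<close>

definition adjacency_spectrum :: "'a pair_pre_digraph \<Rightarrow> real list" where
  "adjacency_spectrum G = rev (sorted_list_of_multiset (proots (char_poly (adjacency_matrix G))))"

definition second_eigenvalue :: "'a pair_pre_digraph \<Rightarrow> real" where
  "second_eigenvalue G =
     max \<bar>adjacency_spectrum G ! 1\<bar> \<bar>adjacency_spectrum G ! (card (pverts G) - 1)\<bar>"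

definition ndlambda_graph :: "nat \<Rightarrow> nat \<Rightarrow> real \<Rightarrow> 'a pair_pre_digraph \<Rightarrow> bool" where
  "ndlambda_graph n d l G \<longleftrightarrow>
     regular_graph d G \<and> card (pverts G) = n \<and> second_eigenvalue G = l"

text \<open>Undirected edges are counted, not arcs.\<close>

definition edges_within :: "'a pair_pre_digraph \<Rightarrow> 'a set \<Rightarrow> nat" where
  "edges_within G U = card {{u, v} | u v. u \<in> U \<and> v \<in> U \<and> (u, v) \<in> parcs G}"

definition max_density :: "'a pair_pre_digraph \<Rightarrow> real \<Rightarrow> real" where
  "max_density G M =
     Max {real (edges_within G U) / real (card U) | U.
            U \<noteq> {} \<and> U \<subseteq> pverts G \<and> real (card U) \<le> M}"

text \<open>In the product measure, the value \<open>True\<close> at a vertex means that the vertex is deleted.\<close>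

definition deletion_pmf :: "'a pair_pre_digraph \<Rightarrow> real \<Rightarrow> ('a, 'a \<times> 'a) pre_digraph pmf" where
  "deletion_pmf G p =
     map_pmf (\<lambda>del. with_proj G \<restriction> {v \<in> pverts G. \<not> del v})
       (Pi_pmf (pverts G) False (\<lambda>_. bernoulli_pmf p))"

end

theory Submission
  imports Defs "Jordan_Normal_Form.Schur_Decomposition"
begin

text \<open>
  If the surviving graph is disconnected, then a set \<open>U\<close> of at most half of the vertices survives,
  induces a connected graph, and has its whole vertex boundary deleted. A union bound
  over such \<open>U\<close> works because the boundary is large in two ways. For large \<open>n\<close> it has at least \<open>d\<close>
  vertices (\<open>boundary_ge_degree\<close>), so the sets of any bounded size contribute
  \<open>O(n p ^ d) = O(n powr (1 - \<alpha> d))\<close>, which vanishes as \<open>\<alpha> > 1 / d\<close>. And it has at least \<open>c |U|\<close> vertices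
  (\<open>boundary_linear\<close>), so the at most \<open>n d^(2 k)\<close> connected sets of size \<open>k\<close> contribute at most
  \<open>n (d\<^sup>2 p powr c) ^ k\<close>, which is negligible for all \<open>k\<close> beyond a constant. The count of connected
  sets comes from walks that cover them (\<open>walk_covering_connected_set\<close>).

  Both expansion properties rest on one inequality (\<open>boundary_spectral_inequality\<close>). The quadratic
  form of the adjacency matrix, evaluated at the function that is \<open>1\<close> on \<open>U\<close> and \<open>1/2\<close> on its boundary of \<open>m\<close>
  vertices, gives \<open>d |U| \<le> \<lambda> (|U| + m / 4) + (d - \<lambda>) (|U| + m / 2)\<^sup>2 / n\<close>. For \<open>|U| \<le> n / 2\<close> this
  is linear expansion. If \<open>m < d\<close>, linear expansion bounds \<open>|U|\<close> by a constant, so for large \<open>n\<close> the last term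
  nearly disappears and \<open>|U|\<close> is at most about \<open>\<lambda> (d - 1) / (4 (d - \<lambda>))\<close>. With the near-Ramanujan
  \<open>\<lambda>\<close> this is less than \<open>31\<close> for \<open>d \<le> 5\<close> and less than \<open>d - 1\<close> for \<open>d \<ge> 6\<close>. The first contradicts the
  density hypothesis, by which sets of at most \<open>30\<close> vertices have at least \<open>d\<close> boundary vertices
  (\<open>small_set_boundary\<close>). The second contradicts it because two vertices have at most two common
  neighbours (\<open>codegree_le_2\<close>), so that \<open>U\<close> and its boundary contain at least \<open>2 d - 2\<close> vertices.

  The second eigenvalue is given by the roots of the characteristic polynomial, whereas the
  argument needs the variational bound on the functions with sum zero. The
  bridge is that the maximum of the form on the unit sphere of these functions is attained at an
  eigenfunction (\<open>quadratic_form_maximiser\<close>), and that this function and the constant one account for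
  two roots of the characteristic polynomial, counted with multiplicity
  (\<open>two_eigenvectors_dvd_char_poly\<close>).
\<close>

section \<open>Rayleigh quotients and the second eigenvalue\<close>

text \<open>
  In a basis that starts with \<open>v\<close> the matrix is block triangular with upper left entry \<open>a\<close>.
  The lower right block has the eigenvalue \<open>m\<close>, because the tail of \<open>y\<close> in the new
  coordinates is an eigenvector of it; that tail is nonzero since \<open>y\<close> is no multiple of \<open>v\<close>.
  The case \<open>a = m\<close> is where the independence matters: then \<open>a\<close> is a multiple root.
\<close>

lemma two_eigenvectors_dvd_char_poly:
  fixes A :: "'a :: conjugatable_ordered_field mat"
  assumes A: "A \<in> carrier_mat n n"
    and v: "v \<in> carrier_vec n" and v0: "v \<noteq> 0\<^sub>v n" and Av: "A *\<^sub>v v = a \<cdot>\<^sub>v v"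
    and y: "y \<in> carrier_vec n" and Ay: "A *\<^sub>v y = m \<cdot>\<^sub>v y"
    and ind: "\<And>c. y \<noteq> c \<cdot>\<^sub>v v"
  shows "[:- a, 1:] * [:- m, 1:] dvd char_poly A"
proof -
  have n: "n \<noteq> 0" using v v0 by auto
  define b where "b = basis_completion v"
  define ws where "ws = gram_schmidt n b"
  define W where "W = mat_of_cols n ws"
  define W' where "W' = corthogonal_inv W"
  define A' where "A' = W' * A * W"
  interpret cof_vec_space n "TYPE('a)" .
  from basis_completion[OF v v0, folded b_def]
  have dist_b: "distinct b" and indep: "\<not> lin_dep (set b)" and b: "set b \<subseteq> carrier_vec n"
    and hdb: "hd b = v" and len_b: "length b = n" by auto
  from hdb len_b n obtain vs where bv: "b = v # vs" by (cases b, auto)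
  from gram_schmidt_result[OF b dist_b indep refl, folded ws_def]
  have ws: "set ws \<subseteq> carrier_vec n" "corthogonal ws" "length ws = n"
    by (auto simp: len_b)
  from gram_schmidt_hd[OF v, of vs, folded bv] have hdws: "hd ws = v" unfolding ws_def .
  have orth_W: "corthogonal_mat W" using orthogonal_mat_of_cols ws unfolding W_def .
  have W: "W \<in> carrier_mat n n"
    using ws unfolding W_def using mat_of_cols_carrier(1)[of n ws] by auto
  have W': "W' \<in> carrier_mat n n"
    unfolding W'_def corthogonal_inv_def using W by (auto simp: mat_of_rows_def)
  have W'W: "W' * W = 1\<^sub>m n"
    using corthogonal_inv_result[OF orth_W] W' unfolding W'_def inverts_mat_def by auto
  have WW': "W * W' = 1\<^sub>m n" using mat_mult_left_right_inverse[OF W' W W'W] .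
  have A': "A' \<in> carrier_mat n n" using W W' A unfolding A'_def by auto
  have sim: "similar_mat A' A" unfolding similar_mat_def
    by (intro exI, rule similar_mat_witI[of W' W n _ A]) (use W W' A A' W'W WW' in \<open>auto simp: A'_def\<close>)
  have col0: "col A' 0 = vec n (\<lambda>i. if i = 0 then a else 0)"
    unfolding A'_def W'_def W_def using corthogonal_col_ev_0[OF A v v0 Av n hdws ws] .
  have A'0: "A' $$ (i, 0) = (if i = 0 then a else 0)" if "i < n" for i
    using arg_cong[OF col0, of "\<lambda>v. v $ i"] A' n that by auto
  define A3 where "A3 = mat (n - 1) (n - 1) (\<lambda>(i, j). A' $$ (Suc i, Suc j))"
  define A2 where "A2 = mat 1 (n - 1) (\<lambda>(i, j). A' $$ (0, Suc j))"
  have A3: "A3 \<in> carrier_mat (n - 1) (n - 1)" by (auto simp: A3_def)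
  have blk: "A' = four_block_mat (mat 1 1 (\<lambda>_. a)) A2 (0\<^sub>m (n - 1) 1) A3"
    using A' n A'0 by (intro eq_matI) (auto simp: A2_def A3_def)
  have "char_poly A' = char_poly (mat 1 1 (\<lambda>_. a)) * char_poly A3"
    unfolding blk by (rule char_poly_four_block_zeros_col[OF _ _ A3]) (auto simp: A2_def)
  also have "char_poly (mat 1 1 (\<lambda>_. a)) = [:- a, 1:]"
    by (simp add: char_poly_defs det_def sign_def)
  finally have cp: "char_poly A = [:- a, 1:] * char_poly A3"
    using char_poly_similar[OF sim] by simp
  define z where "z = W' *\<^sub>v y"
  have z: "z \<in> carrier_vec n" using W' y by (auto simp: z_def)
  have Wz: "W *\<^sub>v z = y"
    unfolding z_def using W W' y WW' by (simp flip: assoc_mult_mat_vec)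
  have A'z: "A' *\<^sub>v z = m \<cdot>\<^sub>v z"
  proof -
    have "A' *\<^sub>v z = W' *\<^sub>v (A *\<^sub>v (W *\<^sub>v z))"
      unfolding A'_def using W W' A z by (simp add: assoc_mult_mat_vec[of _ n n _ n])
    also have "\<dots> = m \<cdot>\<^sub>v z" unfolding Wz Ay using W' y by (simp add: mult_mat_vec z_def)
    finally show ?thesis .
  qed
  define z3 where "z3 = vec (n - 1) (\<lambda>i. z $ Suc i)"
  have "A3 *\<^sub>v z3 = m \<cdot>\<^sub>v z3"
  proof (rule eq_vecI)
    fix i assume "i < dim_vec (m \<cdot>\<^sub>v z3)"
    hence i: "i < n - 1" by (simp add: z3_def)
    have "(A' *\<^sub>v z) $ Suc i = (\<Sum>j<n. A' $$ (Suc i, j) * z $ j)"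
      using i A' z by (auto simp: scalar_prod_def lessThan_atLeast0 intro!: sum.cong)
    also have "\<dots> = (\<Sum>j<Suc (n - 1). A' $$ (Suc i, j) * z $ j)" using n by simp
    also have "\<dots> = (\<Sum>j<n - 1. A' $$ (Suc i, Suc j) * z $ Suc j)"
      using A'0[of "Suc i"] i unfolding sum.lessThan_Suc_shift by simp
    also have "\<dots> = (A3 *\<^sub>v z3) $ i"
      using i by (auto simp: A3_def z3_def scalar_prod_def lessThan_atLeast0 intro!: sum.cong)
    finally show "(A3 *\<^sub>v z3) $ i = (m \<cdot>\<^sub>v z3) $ i"
      using i z unfolding A'z by (simp add: z3_def)
  qed (simp add: A3_def z3_def)
  moreover have "z3 \<noteq> 0\<^sub>v (n - 1)"
  proof
    assume z3: "z3 = 0\<^sub>v (n - 1)"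
    have z0: "z $ i = 0" if i: "i < n" "i \<noteq> 0" for i
      using arg_cong[OF z3, of "\<lambda>v. v $ (i - 1)"] i by (simp add: z3_def)
    have "y $ i = (z $ 0 \<cdot>\<^sub>v v) $ i" if i: "i < n" for i
    proof -
      have "y $ i = (\<Sum>j<n. W $$ (i, j) * z $ j)"
        unfolding Wz[symmetric] using i W z
        by (auto simp: scalar_prod_def lessThan_atLeast0 intro!: sum.cong)
      also have "\<dots> = (\<Sum>j\<in>{0}. W $$ (i, j) * z $ j)"
        using n z0 by (intro sum.mono_neutral_right) auto
      also have "\<dots> = W $$ (i, 0) * z $ 0" by simp
      also have "W $$ (i, 0) = v $ i"
        using i n ws hdws by (cases ws) (auto simp: W_def mat_of_cols_def)
      finally show ?thesis using i v by simp
    qed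
    hence "y = z $ 0 \<cdot>\<^sub>v v" using y v by (intro eq_vecI) auto
    thus False using ind by blast
  qed
  ultimately have "eigenvector A3 z3 m"
    unfolding eigenvector_def using A3 by (simp add: z3_def)
  hence "poly (char_poly A3) m = 0"
    using eigenvalue_root_char_poly[OF A3] unfolding eigenvalue_def by blast
  hence "[:- m, 1:] dvd char_poly A3" by (simp add: poly_eq_0_iff_dvd)
  thus ?thesis unfolding cp by (rule mult_dvd_mono[OF dvd_refl])
qed

lemma zero_if_linear_le_quadratic:
  fixes b c :: real
  assumes "\<And>t. 2 * t * b \<le> t\<^sup>2 * c"
  shows "b = 0"
proof -
  define s where "s = \<bar>c\<bar> + 1"
  have s: "s > 0" "c \<le> s" by (auto simp: s_def)
  have "2 * (b / s) * b \<le> (b / s)\<^sup>2 * c" by (rule assms)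
  also have "\<dots> \<le> (b / s)\<^sup>2 * s" using s by (intro mult_left_mono) auto
  finally have "b\<^sup>2 \<le> 0" using s by (simp add: field_simps power2_eq_square)
  thus ?thesis by simp
qed

text \<open>
  The unit sphere of the functions with sum zero is compact, so the quadratic form attains its
  maximum there, at some \<open>f\<close> with value \<open>m\<close>. Comparing \<open>f + t w\<close> with \<open>f\<close> for all real \<open>t\<close>,
  where \<open>w\<close> is the defect \<open>a f - m f\<close>, shows that \<open>w\<close> has norm zero. Constant row sums
  ensure that \<open>w\<close> has sum zero itself, so that \<open>f + t w\<close> may be compared with \<open>f\<close>.
\<close>

lemma quadratic_form_maximiser:
  fixes a :: "'a \<Rightarrow> 'a \<Rightarrow> real"
  assumes fin: "finite V" and card: "card V \<ge> 2"
    and sym: "\<And>u v. u \<in> V \<Longrightarrow> v \<in> V \<Longrightarrow> a u v = a v u"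
    and rows: "\<And>u. u \<in> V \<Longrightarrow> (\<Sum>v\<in>V. a u v) = r"
  obtains f m where "(\<Sum>v\<in>V. f v) = 0" "(\<Sum>v\<in>V. (f v)\<^sup>2) = 1"
    "\<And>u. u \<in> V \<Longrightarrow> (\<Sum>v\<in>V. a u v * f v) = m * f u"
    "\<And>g. (\<Sum>v\<in>V. g v) = 0 \<Longrightarrow> (\<Sum>u\<in>V. \<Sum>v\<in>V. a u v * g u * g v) \<le> m * (\<Sum>v\<in>V. (g v)\<^sup>2)"
proof -
  define Q where "Q = (\<lambda>g. \<Sum>u\<in>V. \<Sum>v\<in>V. a u v * g u * g v)"
  define K where "K = {g. \<forall>v. g v \<in> (if v \<in> V then {-1..1} else {0::real})}
    \<inter> {g. (\<Sum>v\<in>V. g v) = 0} \<inter> {g. (\<Sum>v\<in>V. (g v)\<^sup>2) = 1}"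
  have "compactin (product_topology (\<lambda>_. euclidean) UNIV)
          (PiE UNIV (\<lambda>v. if v \<in> V then {-1..1} else {0::real}))"
    by (subst compactin_PiE) auto
  hence "compact {g. \<forall>v. g v \<in> (if v \<in> V then {-1..1} else {0::real})}"
    by (simp add: euclidean_product_topology PiE_def Pi_def flip: compactin_euclidean_iff)
  moreover have "closed {g. (\<Sum>v\<in>V. g v) = (0::real)}"
    by (intro closed_Collect_eq continuous_intros continuous_on_product_coordinates)
  moreover have "closed {g. (\<Sum>v\<in>V. (g v)\<^sup>2) = (1::real)}"
    by (intro closed_Collect_eq continuous_intros continuous_on_product_coordinates)
  ultimately have K: "compact K" unfolding K_def by (intro compact_Int_closed)
  have scale: "\<exists>h\<in>K. Q h = Q g / (\<Sum>v\<in>V. (g v)\<^sup>2)"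
    if g: "(\<Sum>v\<in>V. g v) = 0" "(\<Sum>v\<in>V. (g v)\<^sup>2) \<noteq> 0" for g
  proof -
    define N where "N = (\<Sum>v\<in>V. (g v)\<^sup>2)"
    have N: "N > 0" using g(2) sum_nonneg[of V "\<lambda>v. (g v)\<^sup>2"] by (auto simp: N_def order_less_le)
    define h where "h = (\<lambda>v. if v \<in> V then g v / sqrt N else 0)"
    have h1: "(\<Sum>v\<in>V. h v) = 0"
      using g(1) by (simp add: h_def flip: sum_divide_distrib)
    have h2: "(\<Sum>v\<in>V. (h v)\<^sup>2) = 1"
      using N by (simp add: h_def power_divide N_def flip: sum_divide_distrib)
    have "h v \<in> {-1..1}" if "v \<in> V" for v
    proof -
      have "(h v)\<^sup>2 \<le> (\<Sum>v\<in>V. (h v)\<^sup>2)" using fin that by (intro member_le_sum) auto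
      thus ?thesis unfolding h2 using abs_square_le_1[of "h v"] by (auto simp: abs_le_iff)
    qed
    hence "h \<in> K" using h1 h2 by (auto simp: K_def h_def)
    moreover have "Q h = Q g / N"
      using N by (simp add: Q_def h_def sum_divide_distrib)
    ultimately show ?thesis unfolding N_def by blast
  qed
  obtain x y where xy: "x \<in> V" "y \<in> V" "x \<noteq> y"
    using card card_le_Suc0_iff_eq[OF fin] by fastforce
  \<comment> \<open>Two vertices suffice for a nonzero function with sum zero, so the sphere is not empty.\<close>
  define e where "e = (\<lambda>v. (if v = x then 1 else 0) - (if v = y then 1 else (0::real)))"
  have "(\<Sum>v\<in>V. e v) = 0" using fin xy by (simp add: e_def sum_subtractf)
  moreover have "(\<Sum>v\<in>V. (e v)\<^sup>2) \<noteq> 0"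
    using fin xy by (subst sum_nonneg_eq_0_iff) (auto simp: e_def)
  ultimately have "K \<noteq> {}" using scale[of e] by blast
  moreover have "continuous_on K Q" unfolding Q_def
    by (intro continuous_intros continuous_on_subset[OF continuous_on_product_coordinates]) auto
  ultimately obtain f where f: "f \<in> K" "\<And>h. h \<in> K \<Longrightarrow> Q h \<le> Q f"
    using continuous_attains_sup[OF K] by blast
  have f0: "(\<Sum>v\<in>V. f v) = 0" and f1: "(\<Sum>v\<in>V. (f v)\<^sup>2) = 1" using f(1) by (auto simp: K_def)
  define m where "m = Q f"
  have max: "Q g \<le> m * (\<Sum>v\<in>V. (g v)\<^sup>2)" if g: "(\<Sum>v\<in>V. g v) = 0" for g
  proof (cases "(\<Sum>v\<in>V. (g v)\<^sup>2) = 0")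
    case True
    hence "\<forall>v\<in>V. g v = 0" using fin by (subst (asm) sum_nonneg_eq_0_iff) auto
    thus ?thesis using True by (simp add: Q_def)
  next
    case False
    with scale[OF g] f(2) have "Q g / (\<Sum>v\<in>V. (g v)\<^sup>2) \<le> m" unfolding m_def by metis
    moreover have "(\<Sum>v\<in>V. (g v)\<^sup>2) \<ge> 0" by (intro sum_nonneg) auto
    ultimately show ?thesis using False by (simp add: field_simps)
  qed
  define w where "w = (\<lambda>u. (\<Sum>v\<in>V. a u v * f v) - m * f u)"
  have "(\<Sum>u\<in>V. \<Sum>v\<in>V. a u v * f v) = (\<Sum>v\<in>V. \<Sum>u\<in>V. a v u * f v)"
    by (subst sum.swap) (intro sum.cong refl, simp add: sym)
  also have "\<dots> = (\<Sum>v\<in>V. r * f v)"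
    using rows by (simp flip: sum_distrib_right)
  finally have w0: "(\<Sum>v\<in>V. w v) = 0"
    using f0 by (simp add: w_def sum_subtractf flip: sum_distrib_left)
  define B where "B = (\<Sum>u\<in>V. \<Sum>v\<in>V. a u v * f v * w u)"
  define C where "C = (\<Sum>u\<in>V. f u * w u)"
  have B': "B = (\<Sum>u\<in>V. \<Sum>v\<in>V. a u v * f u * w v)"
    unfolding B_def by (subst sum.swap) (intro sum.cong refl, simp add: sym)
  have "2 * t * (B - m * C) \<le> t\<^sup>2 * (m * (\<Sum>v\<in>V. (w v)\<^sup>2) - Q w)" for t
  proof -
    have "Q (\<lambda>v. f v + t * w v) = Q f + t * B + t * (\<Sum>u\<in>V. \<Sum>v\<in>V. a u v * f u * w v) + t\<^sup>2 * Q w"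
      unfolding Q_def B_def sum_distrib_left sum.distrib[symmetric]
      by (intro sum.cong refl) (simp add: algebra_simps power2_eq_square)
    hence "Q (\<lambda>v. f v + t * w v) = m + 2 * t * B + t\<^sup>2 * Q w"
      using B' by (simp add: m_def)
    moreover have "(\<Sum>v\<in>V. (f v + t * w v)\<^sup>2) = (\<Sum>v\<in>V. (f v)\<^sup>2) + 2 * t * C + t\<^sup>2 * (\<Sum>v\<in>V. (w v)\<^sup>2)"
      unfolding C_def sum_distrib_left sum.distrib[symmetric]
      by (intro sum.cong refl) (simp add: algebra_simps power2_eq_square)
    moreover have "(\<Sum>v\<in>V. f v + t * w v) = 0"
      using f0 w0 by (simp add: sum.distrib flip: sum_distrib_left)
    ultimately show ?thesis using max[of "\<lambda>v. f v + t * w v"] f1 by (simp add: algebra_simps)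
  qed
  hence "B - m * C = 0" by (rule zero_if_linear_le_quadratic)
  moreover have "B = (\<Sum>u\<in>V. (\<Sum>v\<in>V. a u v * f v) * w u)"
    by (simp add: B_def sum_distrib_right)
  hence "B - m * C = (\<Sum>u\<in>V. ((\<Sum>v\<in>V. a u v * f v) - m * f u) * w u)"
    by (simp add: C_def sum_distrib_left left_diff_distrib sum_subtractf mult.assoc)
  hence "B - m * C = (\<Sum>u\<in>V. (w u)\<^sup>2)"
    by (simp add: w_def power2_eq_square)
  ultimately have "(\<Sum>u\<in>V. (w u)\<^sup>2) = 0" by simp
  hence "\<forall>u\<in>V. w u = 0" using fin by (subst (asm) sum_nonneg_eq_0_iff) auto
  hence "\<And>u. u \<in> V \<Longrightarrow> (\<Sum>v\<in>V. a u v * f v) = m * f u" by (simp add: w_def)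
  with f0 f1 max that show thesis unfolding Q_def by blast
qed

definition adj :: "'a pair_pre_digraph \<Rightarrow> 'a \<Rightarrow> 'a \<Rightarrow> real" where
  "adj G u v = of_bool ((u, v) \<in> parcs G)"

definition nbrs :: "'a pair_pre_digraph \<Rightarrow> 'a \<Rightarrow> 'a set" where
  "nbrs G u = {v. (u, v) \<in> parcs G}"

lemma regular_graphD:
  assumes "regular_graph d G"
  shows "finite (pverts G)" "finite (parcs G)"
    "\<And>u v. (u, v) \<in> parcs G \<Longrightarrow> (v, u) \<in> parcs G"
    "\<And>u v. (u, v) \<in> parcs G \<Longrightarrow> u \<in> pverts G"
    "\<And>u v. (u, v) \<in> parcs G \<Longrightarrow> v \<in> pverts G"
    "\<And>u v. (u, v) \<in> parcs G \<Longrightarrow> u \<noteq> v"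
    "\<And>u. nbrs G u \<subseteq> pverts G" "\<And>u. finite (nbrs G u)"
    "\<And>u. u \<in> pverts G \<Longrightarrow> card (nbrs G u) = d"
proof -
  interpret pair_graph G using assms by (simp add: regular_graph_def)
  show fin: "finite (pverts G)" "finite (parcs G)" by (rule pair_finite_verts pair_finite_arcs)+
  show "(v, u) \<in> parcs G" if "(u, v) \<in> parcs G" for u v
    using pair_sym_arcs that by (auto simp: symmetric_def sym_def)
  show 1: "u \<in> pverts G" "v \<in> pverts G" if "(u, v) \<in> parcs G" for u v
    using that by (auto dest: in_arcsD1 in_arcsD2)
  show "u \<noteq> v" if "(u, v) \<in> parcs G" for u v using pair_no_loops that by fastforce
  show n: "nbrs G u \<subseteq> pverts G" for u using 1 by (auto simp: nbrs_def)
  show "finite (nbrs G u)" for u using n fin finite_subset by blast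
  show "card (nbrs G u) = d" if "u \<in> pverts G" for u
  proof -
    have "out_degree G u = d" using assms that by (simp add: regular_graph_def)
    moreover have "out_arcs G u = Pair u ` nbrs G u" by (auto simp: out_arcs_def nbrs_def)
    ultimately show ?thesis by (simp add: out_degree_def card_image inj_on_def)
  qed
qed

lemma sum_adj:
  assumes "regular_graph d G" and "W \<subseteq> pverts G"
  shows "(\<Sum>v\<in>W. adj G u v) = real (card (nbrs G u \<inter> W))"
proof -
  have "finite W" using assms regular_graphD(1) finite_subset by blast
  moreover have "W \<inter> {v. (u, v) \<in> parcs G} = nbrs G u \<inter> W" by (auto simp: nbrs_def)
  ultimately show ?thesis by (simp add: adj_def of_bool_def sum.If_cases)
qed

lemma sum_adj_row:
  assumes "regular_graph d G" and "u \<in> pverts G"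
  shows "(\<Sum>v\<in>pverts G. adj G u v) = real d"
  using sum_adj[OF assms(1) order_refl, of u] regular_graphD(7,9)[OF assms(1)] assms(2)
  by (simp add: Int_absorb2)

lemma adj_sym: "regular_graph d G \<Longrightarrow> adj G u v = adj G v u"
  using regular_graphD(3) by (fastforce simp: adj_def)

lemma sorted_desc_two_elements:
  fixes es :: "real list"
  assumes "sorted (rev es)" "{#x, y#} \<subseteq># mset es" "es ! 1 < x"
  shows "y \<le> es ! 1"
proof (rule ccontr)
  assume y: "\<not> y \<le> es ! 1"
  from assms(2) obtain e rest where es: "es = e # rest" by (cases es) auto
  have le: "z \<le> es ! 1" if "z \<in> set rest" for z
    using that assms(1) es by (cases rest) (auto simp: sorted_append)
  have "x \<notin> set rest" "y \<notin> set rest" using le[of x] le[of y] assms(3) y by auto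
  hence c: "count (mset es) x = (if x = e then 1 else 0)" "count (mset es) y = (if y = e then 1 else 0)"
    by (auto simp: es count_eq_zero_iff)
  have "count {#x, y#} x \<le> count (mset es) x" "count {#x, y#} y \<le> count (mset es) y"
    by (rule mset_subset_eq_count[OF assms(2)])+
  thus False unfolding c by (auto split: if_splits)
qed

text \<open>
  The maximum \<open>m\<close> of the form on the functions with sum zero is an eigenvalue, and its eigenfunction
  is independent of the constant eigenfunction for \<open>d\<close>. Hence the spectrum contains \<open>d\<close> and \<open>m\<close> as
  two separate entries; as the entries from index 1 on are below \<open>d\<close>, the entry \<open>d\<close> is the first one
  and \<open>m\<close> is among the others.
\<close>

lemma quadratic_form_le_second_eigenvalue:
  assumes G: "regular_graph d G" and card: "card (pverts G) \<ge> 2"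
    and l: "second_eigenvalue G \<le> l" "l < real d"
    and g: "(\<Sum>v\<in>pverts G. g v) = 0"
  shows "(\<Sum>u\<in>pverts G. \<Sum>v\<in>pverts G. adj G u v * g u * g v) \<le> l * (\<Sum>v\<in>pverts G. (g v)\<^sup>2)"
proof -
  let ?V = "pverts G"
  note GD = regular_graphD[OF G]
  note rows = sum_adj_row[OF G]
  note sym = adj_sym[OF G]
  obtain f m where f0: "(\<Sum>v\<in>?V. f v) = 0" and f1: "(\<Sum>v\<in>?V. (f v)\<^sup>2) = 1"
    and eig: "\<And>u. u \<in> ?V \<Longrightarrow> (\<Sum>v\<in>?V. adj G u v * f v) = m * f u"
    and max: "\<And>g. (\<Sum>v\<in>?V. g v) = 0 \<Longrightarrow>
      (\<Sum>u\<in>?V. \<Sum>v\<in>?V. adj G u v * g u * g v) \<le> m * (\<Sum>v\<in>?V. (g v)\<^sup>2)"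
    by (rule quadratic_form_maximiser[OF GD(1) card sym rows]) (assumption, rule that)
  define vs where "vs = vertex_enum G"
  have vs: "distinct vs" "set vs = ?V"
  proof -
    have "distinct vs \<and> set vs = ?V"
      unfolding vs_def vertex_enum_def
      by (rule someI_ex) (use finite_distinct_list[OF GD(1)] in blast)
    thus "distinct vs" "set vs = ?V" by auto
  qed
  define n where "n = length vs"
  have n: "n \<ge> 2" using card unfolding n_def vs(2)[symmetric] distinct_card[OF vs(1)] .
  have vsV: "vs ! i \<in> ?V" if "i < n" for i using that nth_mem[of i vs] unfolding n_def vs(2) by blast
  have sum_vs: "(\<Sum>i<n. h (vs ! i)) = (\<Sum>v\<in>?V. h v)" for h :: "'a \<Rightarrow> real"
    unfolding n_def vs(2)[symmetric]
    by (rule sum.reindex_bij_betw[OF bij_betw_nth[OF vs(1) refl refl]])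
  define A where "A = adjacency_matrix G"
  have A: "A \<in> carrier_mat n n" by (simp add: A_def adjacency_matrix_def Let_def vs_def n_def)
  have Aij: "A $$ (i, j) = adj G (vs ! i) (vs ! j)" if "i < n" "j < n" for i j
    using that by (simp add: A_def adjacency_matrix_def Let_def vs_def n_def adj_def)
  have Amult: "A *\<^sub>v Matrix.vec n (\<lambda>i. h (vs ! i)) = c \<cdot>\<^sub>v Matrix.vec n (\<lambda>i. h (vs ! i))"
    if "\<And>u. u \<in> ?V \<Longrightarrow> (\<Sum>v\<in>?V. adj G u v * h v) = c * h u" for h c
  proof (rule eq_vecI)
    fix i assume "i < dim_vec (c \<cdot>\<^sub>v Matrix.vec n (\<lambda>i. h (vs ! i)))"
    hence i: "i < n" by simp
    have "(A *\<^sub>v Matrix.vec n (\<lambda>i. h (vs ! i))) $ i = (\<Sum>j<n. adj G (vs ! i) (vs ! j) * h (vs ! j))"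
      using i A Aij by (auto simp: scalar_prod_def lessThan_atLeast0 intro!: sum.cong)
    also have "\<dots> = (\<Sum>v\<in>?V. adj G (vs ! i) v * h v)" by (rule sum_vs)
    finally show "(A *\<^sub>v Matrix.vec n (\<lambda>i. h (vs ! i))) $ i = (c \<cdot>\<^sub>v Matrix.vec n (\<lambda>i. h (vs ! i))) $ i"
      using that[OF vsV[OF i]] i by simp
  qed (use A in simp)
  define one where "one = Matrix.vec n (\<lambda>i. (\<lambda>_. 1 :: real) (vs ! i))"
  define y where "y = Matrix.vec n (\<lambda>i. f (vs ! i))"
  have ind: "y \<noteq> c \<cdot>\<^sub>v one" for c
  proof
    assume eq: "y = c \<cdot>\<^sub>v one"
    have fc: "f (vs ! i) = c" if "i < n" for i
      using arg_cong[OF eq, of "\<lambda>v. v $ i"] that by (simp add: y_def one_def)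
    have "real n * c = 0" using sum_vs[of f] fc f0 by simp
    hence "c = 0" using n by simp
    thus False using sum_vs[of "\<lambda>v. (f v)\<^sup>2"] fc f1 by simp
  qed
  have one0: "one \<noteq> 0\<^sub>v n"
  proof
    assume "one = 0\<^sub>v n"
    hence "one $ 0 = 0\<^sub>v n $ 0" by simp
    thus False using n by (simp add: one_def)
  qed
  have dvd: "[:- real d, 1:] * [:- m, 1:] dvd char_poly A"
    by (rule two_eigenvectors_dvd_char_poly[OF A _ one0, where y = y])
       (use ind rows eig Amult[of "\<lambda>_. 1" "real d"] Amult[of f m] in \<open>auto simp: one_def y_def\<close>)
  then obtain q where q: "char_poly A = [:- real d, 1:] * [:- m, 1:] * q" by (elim dvdE)
  have nz: "char_poly A \<noteq> 0" using degree_monic_char_poly[OF A] by auto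
  hence "q \<noteq> 0" using q by auto
  have "proots (char_poly A) = proots ([:- real d, 1:] * [:- m, 1:]) + proots q"
    unfolding q using \<open>q \<noteq> 0\<close> by (intro proots_mult) (simp_all only: mult_eq_0_iff, simp_all)
  also have "proots ([:- real d, 1:] * [:- m, 1:]) = proots [:- real d, 1:] + proots [:- m, 1:]"
    by (intro proots_mult) simp_all
  finally have sub: "{#real d, m#} \<subseteq># proots (char_poly A)"
    by (simp only: proots_linear_factor minus_minus) (simp add: add_mset_commute)
  define es where "es = adjacency_spectrum G"
  have es: "sorted (rev es)" "mset es = proots (char_poly A)"
    by (auto simp: es_def adjacency_spectrum_def A_def)
  have le: "es ! 1 \<le> l" using l by (auto simp: second_eigenvalue_def es_def)
  have "m \<le> es ! 1"
    by (rule sorted_desc_two_elements[of _ "real d"]) (use es sub le l in auto)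
  hence "m \<le> l" using le by simp
  thus ?thesis
    using max[OF g] by (meson mult_right_mono order_trans sum_nonneg zero_le_power2)
qed

text \<open>
  The expander mixing inequality as a bound on the quadratic form: split \<open>g\<close> into its mean, on
  which the form has the eigenvalue \<open>d\<close>, and a rest with sum zero.
\<close>

lemma quadratic_form_le_mixing:
  assumes G: "regular_graph d G" and card: "card (pverts G) \<ge> 2"
    and l: "second_eigenvalue G \<le> l" "l < real d"
  defines "n \<equiv> real (card (pverts G))"
  shows "(\<Sum>u\<in>pverts G. \<Sum>v\<in>pverts G. adj G u v * g u * g v)
    \<le> l * (\<Sum>v\<in>pverts G. (g v)\<^sup>2) + (real d - l) * (\<Sum>v\<in>pverts G. g v)\<^sup>2 / n"
proof -
  let ?V = "pverts G"
  note GD = regular_graphD[OF G]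
  have n: "n > 0" using card by (simp add: n_def)
  define s where "s = (\<Sum>v\<in>?V. g v)"
  define c where "c = s / n"
  define h where "h = (\<lambda>v. g v - c)"
  note rows = sum_adj_row[OF G]
  note sym = adj_sym[OF G]
  have h0: "(\<Sum>v\<in>?V. h v) = 0" using n by (simp add: h_def c_def sum_subtractf s_def n_def)
  have h2: "(\<Sum>v\<in>?V. (h v)\<^sup>2) = (\<Sum>v\<in>?V. (g v)\<^sup>2) - s\<^sup>2 / n"
  proof -
    have "(\<Sum>v\<in>?V. (h v)\<^sup>2) = (\<Sum>v\<in>?V. (g v)\<^sup>2 - (2 * c) * g v + c\<^sup>2)"
      by (simp add: h_def power2_eq_square algebra_simps)
    also have "\<dots> = (\<Sum>v\<in>?V. (g v)\<^sup>2) - (2 * c) * s + n * c\<^sup>2"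
      unfolding sum.distrib sum_subtractf sum_distrib_left[symmetric] s_def[symmetric]
      by (simp add: n_def)
    also have "\<dots> = (\<Sum>v\<in>?V. (g v)\<^sup>2) - s\<^sup>2 / n" using n by (simp add: c_def field_simps power2_eq_square)
    finally show ?thesis .
  qed
  have row_g: "(\<Sum>u\<in>?V. \<Sum>v\<in>?V. adj G u v * g u) = real d * s"
    using rows by (simp add: s_def sum_distrib_left flip: sum_distrib_right)
  have col_g: "(\<Sum>u\<in>?V. \<Sum>v\<in>?V. adj G u v * g v) = real d * s"
    using row_g by (subst sum.swap) (simp add: sym)
  have all: "(\<Sum>u\<in>?V. \<Sum>v\<in>?V. adj G u v) = real d * n"
    using rows by (simp add: n_def)
  have "(\<Sum>u\<in>?V. \<Sum>v\<in>?V. adj G u v * h u * h v)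
    = (\<Sum>u\<in>?V. \<Sum>v\<in>?V. adj G u v * g u * g v - c * (adj G u v * g u)
        - c * (adj G u v * g v) + c\<^sup>2 * adj G u v)"
    by (intro sum.cong refl) (simp add: h_def power2_eq_square algebra_simps)
  also have "\<dots> = (\<Sum>u\<in>?V. \<Sum>v\<in>?V. adj G u v * g u * g v)
      - c * (real d * s) - c * (real d * s) + c\<^sup>2 * (real d * n)"
    unfolding sum.distrib sum_subtractf sum_distrib_left[symmetric] row_g col_g all by simp
  also have "\<dots> = (\<Sum>u\<in>?V. \<Sum>v\<in>?V. adj G u v * g u * g v) - real d * s\<^sup>2 / n"
    using n by (simp add: c_def field_simps power2_eq_square)
  finally have "(\<Sum>u\<in>?V. \<Sum>v\<in>?V. adj G u v * g u * g v) - real d * s\<^sup>2 / n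
      \<le> l * ((\<Sum>v\<in>?V. (g v)\<^sup>2) - s\<^sup>2 / n)"
    using quadratic_form_le_second_eigenvalue[OF G card l h0] h2 by simp
  thus ?thesis unfolding s_def[symmetric] by (simp add: algebra_simps diff_divide_distrib)
qed

section \<open>Vertex expansion\<close>

definition boundary :: "'a pair_pre_digraph \<Rightarrow> 'a set \<Rightarrow> 'a set" where
  "boundary G U = (\<Union>u\<in>U. nbrs G u) - U"

lemma boundary_subset:
  assumes "regular_graph d G"
  shows "boundary G U \<subseteq> pverts G" "finite (boundary G U)"
proof -
  show 1: "boundary G U \<subseteq> pverts G" using regular_graphD(7)[OF assms] by (auto simp: boundary_def)
  show "finite (boundary G U)" using 1 regular_graphD(1)[OF assms] finite_subset by blast
qed

text \<open>
  The mixing inequality for the function that is \<open>1\<close> on \<open>U\<close> and \<open>1/2\<close> on the boundary. With the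
  weight \<open>1/2\<close> an edge inside \<open>U\<close> and an edge from \<open>U\<close> to its boundary both contribute exactly one per
  endpoint in \<open>U\<close> to the form, so the form is at least \<open>d |U|\<close> and the distribution of the edges at \<open>U\<close>
  does not matter, while a boundary vertex adds only \<open>1/4\<close> to the squared norm.
\<close>

lemma boundary_spectral_inequality:
  assumes G: "regular_graph d G" and card: "card (pverts G) \<ge> 2"
    and l: "second_eigenvalue G \<le> l" "l < real d" and U: "U \<subseteq> pverts G"
  defines "n \<equiv> real (card (pverts G))" and "u \<equiv> real (card U)"
    and "m \<equiv> real (card (boundary G U))"
  shows "real d * u \<le> l * (u + m / 4) + (real d - l) * (u + m / 2)\<^sup>2 / n"
proof -
  let ?V = "pverts G" and ?N = "boundary G U"
  note GD = regular_graphD[OF G]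
  note N = boundary_subset(1)[OF G, of U]
  define g where "g = (\<lambda>v. of_bool (v \<in> U) + of_bool (v \<in> ?N) / (2 :: real))"
  have cU: "(\<Sum>v\<in>?V. of_bool (v \<in> U)) = u"
    using U GD(1) by (simp add: of_bool_def sum.If_cases u_def Int_absorb1)
  have cN: "(\<Sum>v\<in>?V. of_bool (v \<in> ?N)) = m"
    using N GD(1) by (simp add: of_bool_def sum.If_cases m_def Int_absorb1)
  have disj: "\<not> (v \<in> U \<and> v \<in> ?N)" for v by (simp add: boundary_def)
  have g1: "(\<Sum>v\<in>?V. g v) = u + m / 2"
    unfolding g_def sum.distrib cU sum_divide_distrib[symmetric] cN by simp
  have "(g v)\<^sup>2 = of_bool (v \<in> U) + of_bool (v \<in> ?N) / 4" for v
    using disj[of v] by (cases "v \<in> U"; cases "v \<in> ?N") (simp_all add: g_def power2_eq_square)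
  hence g2: "(\<Sum>v\<in>?V. (g v)\<^sup>2) = u + m / 4"
    by (simp only: sum.distrib cU sum_divide_distrib[symmetric] cN)
  note rows = sum_adj_row[OF G]
  note sym = adj_sym[OF G]
  have D: "(\<Sum>u\<in>?V. \<Sum>v\<in>?V. adj G u v * of_bool (u \<in> U)) = real d * u"
    using rows by (simp add: flip: sum_distrib_right) (simp add: cU flip: sum_distrib_left)
  have D': "(\<Sum>u\<in>?V. \<Sum>v\<in>?V. adj G u v * of_bool (v \<in> U)) = real d * u"
    by (subst sum.swap) (subst sym, rule D)
  have "real d * u = (\<Sum>u\<in>?V. \<Sum>v\<in>?V. (adj G u v * of_bool (u \<in> U) + adj G u v * of_bool (v \<in> U)) / 2)"
    unfolding sum_divide_distrib[symmetric] sum.distrib D D' by simp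
  also have "\<dots> \<le> (\<Sum>u\<in>?V. \<Sum>v\<in>?V. adj G u v * g u * g v)"
  proof (intro sum_mono)
    fix x y assume "x \<in> ?V" "y \<in> ?V"
    show "(adj G x y * of_bool (x \<in> U) + adj G x y * of_bool (y \<in> U)) / 2 \<le> adj G x y * g x * g y"
    proof (cases "(x, y) \<in> parcs G")
      case True
      hence "x \<in> U \<Longrightarrow> y \<in> U \<or> y \<in> ?N" "y \<in> U \<Longrightarrow> x \<in> U \<or> x \<in> ?N"
        using GD(3) by (auto simp: boundary_def nbrs_def)
      thus ?thesis using disj[of x] disj[of y] True
        by (cases "x \<in> U"; cases "y \<in> U"; cases "x \<in> ?N"; cases "y \<in> ?N") (simp_all add: g_def adj_def)
    qed (simp add: adj_def)
  qed
  also have "\<dots> \<le> l * (u + m / 4) + (real d - l) * (u + m / 2)\<^sup>2 / n"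
    using quadratic_form_le_mixing[OF G card l, of g] unfolding g1 g2 n_def .
  finally show ?thesis .
qed

text \<open>
  For \<open>m \<le> |U|\<close> the square \<open>(|U| + m / 2)\<^sup>2\<close> is at most \<open>|U| (|U| + 5 m / 4)\<close>, and \<open>|U| \<le> n / 2\<close> makes
  the error term at most half the spectral gap times \<open>|U|\<close>, up to a multiple of \<open>m\<close>. The other half
  of the gap is left for \<open>U\<close>.
\<close>

lemma boundary_linear:
  assumes G: "regular_graph d G" and card: "card (pverts G) \<ge> 2"
    and l: "second_eigenvalue G \<le> l" "0 \<le> l" "l < real d" and U: "U \<subseteq> pverts G"
    and half: "2 * card U \<le> card (pverts G)"
  shows "(real d - l) / (2 * real d) * real (card U) \<le> real (card (boundary G U))"
proof -
  define n u m where "n = real (card (pverts G))" and "u = real (card U)"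
    and "m = real (card (boundary G U))"
  have n: "n > 0" "2 * u \<le> n" and um: "u \<ge> 0" "m \<ge> 0"
    using card half by (auto simp: n_def u_def m_def)
  have d: "real d > 0" using l by linarith
  show ?thesis
  proof (cases "m \<le> u")
    case True
    have "(u + m / 2)\<^sup>2 \<le> u * (u + 5 / 4 * m)"
      using mult_left_mono[OF True um(2)] by (simp add: power2_eq_square algebra_simps)
    also have "\<dots> \<le> n / 2 * (u + 5 / 4 * m)" using n um by (intro mult_right_mono) auto
    finally have "(u + m / 2)\<^sup>2 / n \<le> u / 2 + 5 / 8 * m" using n by (simp add: field_simps)
    hence "(real d - l) * ((u + m / 2)\<^sup>2 / n) \<le> (real d - l) * (u / 2 + 5 / 8 * m)"
      using l by (intro mult_left_mono) auto
    moreover have "real d * u \<le> l * (u + m / 4) + (real d - l) * (u + m / 2)\<^sup>2 / n"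
      using boundary_spectral_inequality[OF G card l(1,3) U] by (simp add: n_def u_def m_def)
    ultimately have "real d * u \<le> l * (u + m / 4) + (real d - l) * (u / 2 + 5 / 8 * m)" by simp
    hence "(real d - l) * u / 2 \<le> (5 / 8 * real d - 3 / 8 * l) * m" by (simp add: field_simps)
    also have "\<dots> \<le> real d * m" using l um by (intro mult_right_mono) auto
    finally show ?thesis using d by (simp add: field_simps u_def m_def)
  next
    case False
    have "(real d - l) / (2 * real d) \<le> 1" using d l by (simp add: field_simps)
    hence "(real d - l) / (2 * real d) * u \<le> 1 * u" using um by (intro mult_right_mono) auto
    thus ?thesis using False by (simp add: u_def m_def)
  qed
qed

text \<open>
  Linear expansion already bounds the size of a set with fewer than \<open>d\<close> boundary vertices by a
  constant. The term with denominator \<open>n\<close> of the spectral inequality is then negligible, and what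
  remains is a much better bound. The constant \<open>1/100\<close> is an arbitrary small slack for that term.
\<close>

lemma small_boundary_imp_small_set:
  assumes G: "regular_graph d G" and card: "card (pverts G) \<ge> 2"
    and l: "second_eigenvalue G \<le> l" "0 \<le> l" "l < real d" and U: "U \<subseteq> pverts G"
    and half: "2 * card U \<le> card (pverts G)"
    and bd: "card (boundary G U) < d"
  defines "c \<equiv> (real d - l) / (2 * real d)"
  assumes large: "100 * real d * (real d / c + real d)\<^sup>2 \<le> real (card (pverts G))"
  shows "(real d - l) * real (card U) \<le> l * (real d - 1) / 4 + 1 / 100"
proof -
  define n u m where "n = real (card (pverts G))" and "u = real (card U)"
    and "m = real (card (boundary G U))"
  have n: "n > 0" and um: "u \<ge> 0" "m \<ge> 0" "m \<le> real d - 1"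
    using card bd by (auto simp: n_def u_def m_def)
  have d: "real d > 0" using l by linarith
  have c: "c > 0" using d l by (simp add: c_def)
  have "c * u \<le> real d"
    using boundary_linear[OF G card l U half] um(3) by (simp add: c_def u_def m_def)
  hence "u \<le> real d / c" using c by (simp add: field_simps)
  hence "(u + m / 2)\<^sup>2 \<le> (real d / c + real d)\<^sup>2" using um by (intro power_mono) auto
  hence "100 * real d * (u + m / 2)\<^sup>2 \<le> 100 * real d * (real d / c + real d)\<^sup>2"
    using d by (intro mult_left_mono) auto
  hence "100 * real d * (u + m / 2)\<^sup>2 \<le> n" using large by (simp add: n_def)
  moreover have "(real d - l) * (u + m / 2)\<^sup>2 \<le> real d * (u + m / 2)\<^sup>2"
    using l by (intro mult_right_mono) auto
  ultimately have small: "(real d - l) * (u + m / 2)\<^sup>2 / n \<le> 1 / 100" using n by (simp add: field_simps)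
  have "real d * u \<le> l * (u + m / 4) + (real d - l) * (u + m / 2)\<^sup>2 / n"
    using boundary_spectral_inequality[OF G card l(1,3) U] by (simp add: n_def u_def m_def)
  also have "\<dots> \<le> l * (u + (real d - 1) / 4) + 1 / 100"
    using small um l by (intro add_mono mult_left_mono) auto
  finally show ?thesis by (simp add: u_def algebra_simps)
qed

section \<open>Local sparsity\<close>

text \<open>
  The edges inside \<open>U\<close> are counted twice on the left, those from \<open>U\<close> to the rest of \<open>W\<close> once.
\<close>

lemma degree_sum_le_edges_within:
  assumes G: "regular_graph d G" and UW: "U \<subseteq> W" and W: "W \<subseteq> pverts G"
  shows "(\<Sum>u\<in>U. card (nbrs G u \<inter> W)) \<le> edges_within G W + edges_within G U"
proof -
  note GD = regular_graphD[OF G]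
  have finW: "finite W" by (rule finite_subset[OF W GD(1)])
  note fin = finW finite_subset[OF UW finW]
  define E where "E = (\<lambda>U. {{u, v} | u v. u \<in> U \<and> v \<in> U \<and> (u, v) \<in> parcs G})"
  have ew: "edges_within G X = card (E X)" for X by (simp add: edges_within_def E_def)
  have finE: "finite (E X)" if "finite X" for X
    by (rule finite_subset[of _ "Pow X"]) (use that in \<open>auto simp: E_def\<close>)
  define f where "f = (\<lambda>(u :: 'a, v). {u, v})"
  define B1 where "B1 = (SIGMA u:U. nbrs G u \<inter> (W - U))"
  define B2 where "B2 = (SIGMA u:U. nbrs G u \<inter> U)"
  have finB: "finite B1" "finite B2" using fin by (auto simp: B1_def B2_def)
  have "(\<Sum>u\<in>U. card (nbrs G u \<inter> W)) = card (SIGMA u:U. nbrs G u \<inter> W)"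
    by (rule card_SigmaI[symmetric]) (use fin in auto)
  also have "(SIGMA u:U. nbrs G u \<inter> W) = B1 \<union> B2" using UW by (auto simp: B1_def B2_def)
  also have "card (B1 \<union> B2) \<le> card B1 + card B2" by (rule card_Un_le)
  finally have "(\<Sum>u\<in>U. card (nbrs G u \<inter> W)) \<le> card B1 + card B2" .
  moreover have "card B1 + card (E U) \<le> card (E W)"
  proof -
    have "inj_on f B1"
    proof (rule inj_onI)
      fix p q assume "p \<in> B1" "q \<in> B1" "f p = f q"
      thus "p = q" by (cases p; cases q) (auto simp: f_def B1_def doubleton_eq_iff)
    qed
    hence "card B1 + card (E U) = card (f ` B1) + card (E U)" by (simp add: card_image)
    also have "\<dots> = card (f ` B1 \<union> E U)"
    proof (rule card_Un_disjoint[symmetric])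
      have "e \<subseteq> U" if "e \<in> E U" for e using that by (auto simp: E_def)
      moreover have "\<not> e \<subseteq> U" if "e \<in> f ` B1" for e using that by (auto simp: f_def B1_def)
      ultimately show "f ` B1 \<inter> E U = {}" by blast
    qed (use finB finE[OF fin(2)] in auto)
    also have "\<dots> \<le> card (E W)"
    proof (rule card_mono[OF finE[OF fin(1)]])
      have "f p \<in> E W" if "p \<in> B1" for p
        using that UW by (cases p) (auto simp: f_def B1_def E_def nbrs_def)
      moreover have "E U \<subseteq> E W" using UW unfolding E_def by blast
      ultimately show "f ` B1 \<union> E U \<subseteq> E W" by blast
    qed
    finally show ?thesis .
  qed
  moreover have "card B2 \<le> 2 * card (E U)"
  proof -
    have fE: "f p \<in> E U" if "p \<in> B2" for p
      using that by (cases p) (auto simp: B2_def E_def f_def nbrs_def)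
    have "B2 \<subseteq> (\<Union>e\<in>E U. {p \<in> B2. f p = e})"
      by (rule subsetI, rule UN_I[OF fE]) simp_all
    moreover have "finite (\<Union>e\<in>E U. {p \<in> B2. f p = e})"
      by (rule finite_UN_I[OF finE[OF fin(2)]]) (simp add: finB)
    ultimately have "card B2 \<le> card (\<Union>e\<in>E U. {p \<in> B2. f p = e})"
      by (intro card_mono)
    also have "\<dots> \<le> (\<Sum>e\<in>E U. card {p \<in> B2. f p = e})" by (rule card_UN_le[OF finE[OF fin(2)]])
    also have "\<dots> \<le> (\<Sum>e\<in>E U. 2)"
    proof (rule sum_mono)
      fix e assume "e \<in> E U"
      then obtain x y where e: "e = {x, y}" by (auto simp: E_def)
      have "card {p \<in> B2. f p = e} \<le> card {(x, y), (y, x)}"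
      proof (rule card_mono)
        show "{p \<in> B2. f p = e} \<subseteq> {(x, y), (y, x)}"
        proof (rule subsetI)
          fix p assume "p \<in> {p \<in> B2. f p = e}"
          thus "p \<in> {(x, y), (y, x)}" by (cases p) (simp add: e f_def doubleton_eq_iff)
        qed
      qed simp
      also have "\<dots> \<le> 2" using card_length[of "[(x, y), (y, x)]"] by simp
      finally show "card {p \<in> B2. f p = e} \<le> 2" .
    qed
    finally show ?thesis by simp
  qed
  ultimately show ?thesis unfolding ew by linarith
qed

lemma edges_within_le_card:
  assumes G: "regular_graph d G" and dens: "max_density G M \<le> 1"
    and W: "W \<noteq> {}" "W \<subseteq> pverts G" "real (card W) \<le> M"
  shows "edges_within G W \<le> card W"
proof -
  note GD = regular_graphD[OF G]
  let ?S = "{real (edges_within G U) / real (card U) | U.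
               U \<noteq> {} \<and> U \<subseteq> pverts G \<and> real (card U) \<le> M}"
  have "finite ?S"
    by (rule finite_subset[of _ "(\<lambda>U. real (edges_within G U) / real (card U)) ` Pow (pverts G)"])
       (use GD(1) in auto)
  hence "real (edges_within G W) / real (card W) \<le> max_density G M"
    unfolding max_density_def using W by (intro Max_ge) auto
  hence "real (edges_within G W) / real (card W) \<le> 1" using dens by simp
  moreover have "card W > 0" using W GD(1) finite_subset card_gt_0_iff by metis
  ultimately show ?thesis by (simp add: field_simps)
qed

lemma edges_within_pair_le: "edges_within G {x, y} \<le> 1" if "regular_graph d G"
proof -
  have "edges_within G {x, y} \<le> card {{x, y}}"
    unfolding edges_within_def using regular_graphD(6)[OF that]
    by (intro card_mono) (auto simp: insert_commute)
  thus ?thesis by simp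
qed

text \<open>
  Apply the density hypothesis to \<open>x\<close>, \<open>y\<close> and the neighbours of \<open>x\<close>. These are about \<open>d + 2\<close>
  vertices; the edges at \<open>x\<close> use up \<open>d\<close> of the allowance and every common neighbour adds another
  edge, at \<open>y\<close>. The number \<open>\<epsilon>\<close> corrects both counts when \<open>x\<close> and \<open>y\<close> are adjacent.
\<close>

lemma codegree_le_2:
  assumes G: "regular_graph d G" and dens: "max_density G (real d + 29) \<le> 1"
    and xy: "x \<in> pverts G" "y \<in> pverts G" "x \<noteq> y"
  shows "card (nbrs G x \<inter> nbrs G y) \<le> 2"
proof -
  note GD = regular_graphD[OF G]
  define W where "W = {x, y} \<union> nbrs G x"
  define \<epsilon> :: nat where "\<epsilon> = of_bool ((x, y) \<in> parcs G)"
  have WV: "W \<subseteq> pverts G" using GD(7) xy by (auto simp: W_def)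
  have finW: "finite W" using GD(8) by (simp add: W_def)
  have x: "x \<notin> nbrs G x" and y: "y \<notin> nbrs G y" using GD(6) by (auto simp: nbrs_def)
  have cW: "card W + \<epsilon> = d + 2"
    using GD(8)[of x] GD(9)[OF xy(1)] xy(3) x
    by (auto simp: W_def \<epsilon>_def card_insert_if nbrs_def)
  have "edges_within G {x, y} \<le> \<epsilon>"
  proof (cases "(x, y) \<in> parcs G")
    case False
    hence "{{u, v} | u v. u \<in> {x, y} \<and> v \<in> {x, y} \<and> (u, v) \<in> parcs G} = {}"
      using GD(3,6) by auto
    hence "edges_within G {x, y} = 0" by (simp only: edges_within_def card.empty)
    thus ?thesis by simp
  qed (use edges_within_pair_le[OF G] in \<open>simp add: \<epsilon>_def\<close>)
  moreover have "edges_within G W \<le> card W"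
    by (rule edges_within_le_card[OF G dens]) (use WV cW in \<open>auto simp: W_def\<close>)
  moreover have "(\<Sum>u\<in>{x, y}. card (nbrs G u \<inter> W)) \<le> edges_within G W + edges_within G {x, y}"
    by (rule degree_sum_le_edges_within[OF G _ WV]) (simp add: W_def)
  moreover have "nbrs G x \<inter> W = nbrs G x" by (auto simp: W_def)
  moreover have "card (nbrs G x \<inter> nbrs G y) + \<epsilon> \<le> card (nbrs G y \<inter> W)"
  proof -
    have "card (nbrs G x \<inter> nbrs G y) + \<epsilon> = card ((nbrs G x \<inter> nbrs G y) \<union> (if (x, y) \<in> parcs G then {x} else {}))"
      using GD(8) x by (auto simp: \<epsilon>_def card_insert_if)
    also have "\<dots> \<le> card (nbrs G y \<inter> W)"
      using finW GD(3) by (intro card_mono) (auto simp: W_def nbrs_def)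
    finally show ?thesis .
  qed
  ultimately show ?thesis using cW xy(3) GD(9)[OF xy(1)] by simp
qed

text \<open>
  If the boundary had fewer than \<open>d\<close> vertices, then \<open>U\<close> and its boundary together would have
  at most \<open>d + 29\<close>, and this union contains all edges at \<open>U\<close>. Sparsity of the union and of \<open>U\<close> gives
  \<open>(d - 2) |U| \<le> |boundary|\<close>, which is enough for three or more vertices. The
  boundary of a single vertex is its neighbourhood, and a pair needs the sharper bound of one
  edge inside \<open>U\<close>.
\<close>

lemma small_set_boundary:
  assumes G: "regular_graph d G" and d: "d \<ge> 3" and dens: "max_density G (real d + 29) \<le> 1"
    and U: "U \<subseteq> pverts G" "U \<noteq> {}" "card U \<le> 30"
  shows "d \<le> card (boundary G U)"
proof (rule ccontr)
  assume less: "\<not> d \<le> card (boundary G U)"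
  note GD = regular_graphD[OF G]
  have finU: "finite U" using U GD(1) finite_subset by blast
  note N = boundary_subset[OF G, of U]
  define W where "W = U \<union> boundary G U"
  have WV: "W \<subseteq> pverts G" using U N by (simp add: W_def)
  have nW: "nbrs G u \<inter> W = nbrs G u" if "u \<in> U" for u using that by (auto simp: W_def boundary_def)
  have cW: "card W = card U + card (boundary G U)"
    unfolding W_def using finU N by (intro card_Un_disjoint) (auto simp: boundary_def)
  have "(\<Sum>u\<in>U. card (nbrs G u \<inter> W)) = (\<Sum>u\<in>U. d)"
    using nW U GD(9) by (intro sum.cong) auto
  hence "d * card U = (\<Sum>u\<in>U. card (nbrs G u \<inter> W))" by simp
  also have "\<dots> \<le> edges_within G W + edges_within G U"
    by (rule degree_sum_le_edges_within[OF G _ WV]) (simp add: W_def)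
  also have "edges_within G W \<le> card W"
    by (rule edges_within_le_card[OF G dens]) (use WV cW U less in \<open>auto simp: W_def\<close>)
  finally have main: "d * card U \<le> card U + card (boundary G U) + edges_within G U"
    unfolding cW by simp
  have eU: "edges_within G U \<le> card U"
    by (rule edges_within_le_card[OF G dens]) (use U d in auto)
  have "card U > 0" using U finU by (simp add: card_gt_0_iff)
  then consider "card U = 1" | "card U = 2" | "card U \<ge> 3" by linarith
  thus False
  proof cases
    case 1
    then obtain u where u: "U = {u}" by (auto simp: card_1_singleton_iff)
    hence "boundary G U = nbrs G u" using GD(6) by (auto simp: boundary_def nbrs_def)
    thus False using less GD(9)[of u] U u by simp
  next
    case 2
    then obtain x y where "U = {x, y}" by (auto simp: card_2_iff)
    hence "edges_within G U \<le> 1" using edges_within_pair_le[OF G] by simp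
    thus False using main less d 2 by simp
  next
    case 3
    obtain k where k: "d = k + 3" using d by (metis add.commute le_Suc_ex)
    have "(k + 1) * 3 \<le> (k + 1) * card U" using 3 by (intro mult_left_mono) auto
    thus False using main eU less k by (simp add: algebra_simps)
  qed
qed

text \<open>
  The numerical content of the bound on \<open>\<lambda>\<close>. It leaves a spectral gap, which for \<open>d = 3\<close> is only about
  \<open>0.147\<close>. The other two claims turn the bound of \<open>small_boundary_imp_small_set\<close> into \<open>|U| < 31\<close> for
  \<open>d \<le> 5\<close> and into \<open>|U| < d - 1\<close> for \<open>d \<ge> 6\<close>.
\<close>

lemma ramanujan_gap:
  assumes d: "d \<ge> 3"
  defines "l \<equiv> 2 * sqrt (real d - 1) + 1 / 40"
  shows "l < real d"
    "d \<le> 5 \<Longrightarrow> l * (real d - 1) / 4 + 1 / 100 < 31 * (real d - l)"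
    "d \<ge> 6 \<Longrightarrow> 1 / 50 \<le> real d - 5 / 4 * l"
proof -
  define s where "s = sqrt (real d - 1)"
  have s2: "s\<^sup>2 = real d - 1" and s0: "s \<ge> 0" using d by (auto simp: s_def)
  have l: "l = 2 * s + 1 / 40" by (simp add: l_def s_def)
  have lb: "s \<ge> 7 / 5"
    by (rule power2_le_imp_le[OF _ s0], unfold s2) (use d in \<open>simp add: power2_eq_square\<close>)
  have "real d - l = (s - 1)\<^sup>2 - 1 / 40" using s2 by (simp add: l power2_eq_square algebra_simps)
  moreover have "(2 / 5 :: real)\<^sup>2 \<le> (s - 1)\<^sup>2" using lb by (intro power_mono) auto
  ultimately have gap: "real d - l \<ge> 27 / 200" by (simp add: power2_eq_square)
  thus "l < real d" by simp
  show "l * (real d - 1) / 4 + 1 / 100 < 31 * (real d - l)" if "d \<le> 5"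
  proof (cases "d = 5")
    case True
    hence "s = 2" by (simp add: s_def)
    thus ?thesis using True by (simp add: l)
  next
    case False
    hence "real d \<le> 4" using that by simp
    hence "l * (real d - 1) \<le> (4 - 27 / 200) * 3"
      using gap d s0 by (intro mult_mono) (auto simp: l)
    thus ?thesis using gap by simp
  qed
  show "1 / 50 \<le> real d - 5 / 4 * l" if "d \<ge> 6"
  proof -
    have "s \<ge> 11 / 5"
    by (rule power2_le_imp_le[OF _ s0], unfold s2) (use that in \<open>simp add: power2_eq_square\<close>)
    hence "(s - 11 / 5) * (s - 3 / 10) \<ge> 0" by simp
    thus ?thesis using s2 by (simp add: l power2_eq_square algebra_simps)
  qed
qed

text \<open>
  Sets of at most 30 vertices are covered by local sparsity. For a larger set with fewer than \<open>d\<close>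
  boundary vertices the spectral bound is contradictory: directly if \<open>d \<le> 5\<close>, and if \<open>d \<ge> 6\<close> because
  two vertices of \<open>U\<close> have at least \<open>2 d - 2\<close> neighbours between them, all in \<open>U\<close> or its boundary, so
  that \<open>U\<close> has at least \<open>d - 1\<close> elements.
\<close>

lemma boundary_ge_degree:
  assumes G: "regular_graph d G" and d: "d \<ge> 3" and dens: "max_density G (real d + 29) \<le> 1"
  defines "l \<equiv> 2 * sqrt (real d - 1) + 1 / 40"
  defines "c \<equiv> (real d - l) / (2 * real d)"
  assumes l: "second_eigenvalue G \<le> l"
    and U: "U \<subseteq> pverts G" "U \<noteq> {}" "2 * card U \<le> card (pverts G)"
    and large: "100 * real d * (real d / c + real d)\<^sup>2 \<le> real (card (pverts G))"
  shows "d \<le> card (boundary G U)"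
proof (rule ccontr)
  assume "\<not> d \<le> card (boundary G U)"
  hence bd: "card (boundary G U) < d" by simp
  note GD = regular_graphD[OF G]
  have finU: "finite U" using U GD(1) finite_subset by blast
  have big: "card U \<ge> 31" using small_set_boundary[OF G d dens U(1,2)] bd by linarith
  have card: "card (pverts G) \<ge> 2" using big U(3) by linarith
  have l0: "0 \<le> l" using d by (simp add: l_def)
  have ld: "l < real d" using ramanujan_gap(1)[OF d] by (simp add: l_def)
  have ineq: "(real d - l) * real (card U) \<le> l * (real d - 1) / 4 + 1 / 100"
    using small_boundary_imp_small_set[OF G card l l0 ld U(1,3) bd] large by (simp add: c_def)
  show False
  proof (cases "d \<le> 5")
    case True
    have "31 * (real d - l) \<le> (real d - l) * real (card U)"
      using big ld by (subst mult.commute) (intro mult_left_mono, auto)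
    with ineq ramanujan_gap(2)[OF d True] show False by (simp add: l_def)
  next
    case False
    obtain x y where xy: "x \<in> U" "y \<in> U" "x \<noteq> y"
      using big card_le_Suc0_iff_eq[OF finU] by fastforce
    have xyV: "x \<in> pverts G" "y \<in> pverts G" using xy U(1) by auto
    have "card (nbrs G x \<union> nbrs G y) + card (nbrs G x \<inter> nbrs G y) = 2 * d"
      using card_Un_Int[OF GD(8)[of x] GD(8)[of y]] GD(9)[OF xyV(1)] GD(9)[OF xyV(2)] by simp
    moreover have "card (nbrs G x \<inter> nbrs G y) \<le> 2"
      by (rule codegree_le_2[OF G dens xyV xy(3)])
    moreover have "card (nbrs G x \<union> nbrs G y) \<le> card (U \<union> boundary G U)"
      using finU boundary_subset[OF G, of U] xy by (intro card_mono) (auto simp: boundary_def)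
    moreover have "card (U \<union> boundary G U) \<le> card U + card (boundary G U)" by (rule card_Un_le)
    ultimately have "d \<le> card U + 1" using bd by linarith
    hence "(real d - l) * (real d - 1) \<le> (real d - l) * real (card U)"
      using ld by (intro mult_left_mono) auto
    hence "(real d - 1) * (real d - 5 / 4 * l) \<le> 1 / 100" using ineq by (simp add: field_simps)
    moreover have "5 * (1 / 50) \<le> (real d - 1) * (real d - 5 / 4 * l)"
      using ramanujan_gap(3) False by (intro mult_mono) (auto simp: l_def)
    ultimately show False by simp
  qed
qed

section \<open>Counting connected sets by walks\<close>

text \<open>
  The index is the number of steps, so a walk in \<open>walks G m\<close> lists \<open>m + 1\<close> vertices.
\<close>

definition walks :: "'a pair_pre_digraph \<Rightarrow> nat \<Rightarrow> 'a list set" where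
  "walks G m = {w. length w = Suc m \<and> set w \<subseteq> pverts G \<and> successively (\<lambda>u v. (u, v) \<in> parcs G) w}"

lemma walks_count:
  assumes G: "regular_graph d G"
  shows "finite (walks G m) \<and> card (walks G m) \<le> card (pverts G) * d ^ m"
proof (induction m)
  case 0
  have sub: "walks G 0 \<subseteq> (\<lambda>v. [v]) ` pverts G"
    by (auto simp: walks_def length_Suc_conv)
  show ?case
    using surj_card_le[OF regular_graphD(1)[OF G] sub]
      finite_subset[OF sub finite_imageI[OF regular_graphD(1)[OF G]]] by simp
next
  case (Suc m)
  note GD = regular_graphD[OF G]
  define S where "S = (SIGMA w:walks G m. nbrs G (hd w))"
  have sub: "walks G (Suc m) \<subseteq> (\<lambda>(w, x). x # w) ` S"
  proof
    fix w assume w: "w \<in> walks G (Suc m)"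
    then obtain x y ws where xy: "w = x # y # ws"
      by (auto simp: walks_def length_Suc_conv)
    hence "(y # ws, x) \<in> S" using w GD(3) by (auto simp: S_def walks_def nbrs_def)
    thus "w \<in> (\<lambda>(w, x). x # w) ` S" using xy by force
  qed
  have finS: "finite S" using Suc GD(8) by (auto simp: S_def)
  have "hd w \<in> pverts G" if "w \<in> walks G m" for w
    using that by (cases w) (auto simp: walks_def)
  hence "(\<Sum>w\<in>walks G m. card (nbrs G (hd w))) = (\<Sum>w\<in>walks G m. d)"
    using GD(9) by (intro sum.cong) auto
  hence "card S = card (walks G m) * d"
    unfolding S_def using Suc GD(8) by (subst card_SigmaI) auto
  also have "\<dots> \<le> card (pverts G) * d ^ m * d" using Suc by (intro mult_right_mono) auto
  finally have "card S \<le> card (pverts G) * d ^ Suc m" by (simp add: mult.commute mult.left_commute)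
  moreover have "card (walks G (Suc m)) \<le> card S" by (rule surj_card_le[OF finS sub])
  moreover have "finite (walks G (Suc m))" using finite_subset[OF sub finite_imageI[OF finS]] .
  ultimately show ?case by linarith
qed

text \<open>
  Grow the walk: while it does not cover \<open>U\<close>, some edge \<open>(a, b)\<close> leads from a visited to an
  unvisited vertex of \<open>U\<close>, and the detour \<open>a, b, a\<close> can be inserted at an occurrence of \<open>a\<close>. Each new
  vertex costs two steps. Together with \<open>walks_count\<close> this bounds the number of connected
  sets of size \<open>k\<close> by \<open>n d^(2 k)\<close>. Connectivity is assumed in the form in which it is used: every proper
  nonempty part of \<open>U\<close> has an edge to its complement in \<open>U\<close>.
\<close>

lemma walk_covering_connected_set:
  assumes G: "regular_graph d G" and U: "U \<subseteq> pverts G" "U \<noteq> {}"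
    and conn: "\<And>A. A \<noteq> {} \<Longrightarrow> A \<subset> U \<Longrightarrow> \<exists>a\<in>A. \<exists>b\<in>U - A. (a, b) \<in> parcs G"
  shows "\<exists>w\<in>walks G (2 * (card U - 1)). set w = U"
proof -
  note GD = regular_graphD[OF G]
  have finU: "finite U" by (rule finite_subset[OF U(1) GD(1)])
  have "\<exists>w\<in>walks G (2 * j). set w \<subseteq> U \<and> card (set w) = Suc j" if "Suc j \<le> card U" for j
    using that
  proof (induction j)
    case 0
    obtain x where "x \<in> U" using U(2) by blast
    hence "[x] \<in> walks G (2 * 0)" "set [x] \<subseteq> U" using U by (auto simp: walks_def)
    thus ?case by (intro bexI[of _ "[x]"]) auto
  next
    case (Suc j)
    then obtain w where w: "w \<in> walks G (2 * j)" "set w \<subseteq> U" "card (set w) = Suc j" by auto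
    have "set w \<noteq> {}" "set w \<subset> U" using w Suc.prems by (auto simp: walks_def)
    then obtain a b where ab: "a \<in> set w" "b \<in> U - set w" "(a, b) \<in> parcs G" using conn by blast
    then obtain xs ys where xs: "w = xs @ a # ys" by (auto simp: in_set_conv_decomp)
    define w' where "w' = xs @ a # b # a # ys"
    have "w' \<in> walks G (2 * Suc j)"
      using w(1) ab GD(3)[OF ab(3)] U
      by (auto simp: walks_def w'_def xs successively_append_iff successively_Cons)
    moreover have "set w' = insert b (set w)" by (auto simp: w'_def xs)
    ultimately show ?case using w ab by (intro bexI[of _ w']) auto
  qed
  from this[of "card U - 1"] obtain w where
    w: "w \<in> walks G (2 * (card U - 1))" "set w \<subseteq> U" "card (set w) = card U"
    using U finU by (auto simp: card_gt_0_iff)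
  have "set w = U" by (rule card_subset_eq[OF finU w(2,3)])
  thus ?thesis using w(1) by blast
qed

lemma connected_induce_subgraphI:
  assumes R: "R \<noteq> {}" "R \<subseteq> pverts G"
    and all: "\<And>a b. a \<in> R \<Longrightarrow> b \<in> R \<Longrightarrow> (a, b) \<in> (parcs G \<inter> R \<times> R)\<^sup>*"
  shows "Digraph_Component.connected (with_proj G \<restriction> R)"
proof -
  define M where "M = mk_symmetric (with_proj G \<restriction> R)"
  have M: "pverts M = R" "parcs G \<inter> R \<times> R \<subseteq> parcs M"
    by (auto simp: M_def mk_symmetric_def induce_subgraph_def)
  have "a \<rightarrow>\<^sup>*\<^bsub>with_proj M\<^esub> b" if ab: "a \<in> R" "b \<in> R" for a b
  proof -
    have "(a, b) \<in> rtrancl_on R (parcs G \<inter> R \<times> R)"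
      by (rule rtrancl_consistent_rtrancl_on[OF all[OF ab] ab]) auto
    hence "(a, b) \<in> rtrancl_on R (parcs M)" by (rule rtrancl_on_mono[OF M(2) order_refl])
    thus ?thesis by (simp add: reachable_def M(1))
  qed
  thus ?thesis
    unfolding Digraph_Component.connected_def M_def[symmetric]
    using R M(1) by (auto simp: strongly_connected_def)
qed

lemma rtrancl_leaves_set:
  assumes "(a, b) \<in> r\<^sup>*" "a \<in> A" "b \<notin> A"
  shows "\<exists>p q. p \<in> A \<and> q \<notin> A \<and> (p, q) \<in> r"
  using assms by (induction rule: rtrancl_induct) blast+

text \<open>
  The smaller one of two different components.
\<close>

lemma disconnected_imp_isolated_piece:
  assumes G: "regular_graph d G" and R: "R \<noteq> {}" "R \<subseteq> pverts G"
    and nc: "\<not> Digraph_Component.connected (with_proj G \<restriction> R)"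
  obtains U where "U \<noteq> {}" "U \<subseteq> R" "2 * card U \<le> card R" "boundary G U \<inter> R = {}"
    "\<And>A. A \<noteq> {} \<Longrightarrow> A \<subset> U \<Longrightarrow> \<exists>a\<in>A. \<exists>b\<in>U - A. (a, b) \<in> parcs G"
proof -
  note GD = regular_graphD[OF G]
  have finR: "finite R" by (rule finite_subset[OF R(2) GD(1)])
  define r where "r = parcs G \<inter> R \<times> R"
  have symr: "sym r" using GD(3) by (auto simp: r_def sym_def)
  have sym: "(y, x) \<in> r\<^sup>*" if "(x, y) \<in> r\<^sup>*" for x y
    using symD[OF sym_rtrancl[OF symr] that] .
  define C where "C = (\<lambda>x. {y. (x, y) \<in> r\<^sup>*})"
  have CR: "C x \<subseteq> R" if x: "x \<in> R" for x
  proof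
    fix y assume "y \<in> C x"
    hence "(x, y) \<in> r\<^sup>*" by (simp add: C_def)
    thus "y \<in> R" using x by (induction rule: rtrancl_induct) (auto simp: r_def)
  qed
  have Cbd: "boundary G (C x) \<inter> R = {}" if x: "x \<in> R" for x
  proof -
    have "v \<in> C x" if uv: "u \<in> C x" "(u, v) \<in> parcs G" "v \<in> R" for u v
    proof -
      have "(u, v) \<in> r" using uv CR[OF x] by (auto simp: r_def)
      thus ?thesis using uv(1) by (auto simp: C_def intro: rtrancl_into_rtrancl)
    qed
    thus ?thesis by (auto simp: boundary_def nbrs_def)
  qed
  have Cconn: "\<exists>p\<in>A. \<exists>q\<in>C x - A. (p, q) \<in> parcs G" if A: "A \<noteq> {}" "A \<subset> C x" for A x
  proof -
    obtain a b where ab: "a \<in> A" "b \<in> C x" "b \<notin> A" using A by blast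
    have "(x, a) \<in> r\<^sup>*" "(x, b) \<in> r\<^sup>*" using ab A(2) by (auto simp: C_def)
    hence "(a, b) \<in> r\<^sup>*" using rtrancl_trans[OF sym] by blast
    then obtain p q where pq: "p \<in> A" "q \<notin> A" "(p, q) \<in> r"
      using rtrancl_leaves_set[OF _ ab(1,3)] by blast
    have "(x, p) \<in> r\<^sup>*" using pq(1) A(2) by (auto simp: C_def)
    hence "q \<in> C x" using pq(3) by (simp add: C_def rtrancl_into_rtrancl)
    thus ?thesis using pq by (auto simp: r_def)
  qed
  obtain a b where ab: "a \<in> R" "b \<in> R" "(a, b) \<notin> r\<^sup>*"
  proof -
    have "\<not> (\<forall>a\<in>R. \<forall>b\<in>R. (a, b) \<in> r\<^sup>*)"
      using connected_induce_subgraphI[OF R] nc unfolding r_def by blast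
    thus ?thesis using that by blast
  qed
  have "C a \<inter> C b = {}"
  proof (rule ccontr)
    assume "C a \<inter> C b \<noteq> {}"
    then obtain z where "(a, z) \<in> r\<^sup>*" "(b, z) \<in> r\<^sup>*" by (auto simp: C_def)
    thus False using ab(3) rtrancl_trans[OF _ sym] by blast
  qed
  hence "card (C a) + card (C b) = card (C a \<union> C b)"
    using finite_subset[OF CR[OF ab(1)] finR] finite_subset[OF CR[OF ab(2)] finR]
    by (simp add: card_Un_disjoint)
  also have "\<dots> \<le> card R" using CR[OF ab(1)] CR[OF ab(2)] finR by (intro card_mono) auto
  finally have "2 * card (C a) \<le> card R \<or> 2 * card (C b) \<le> card R" by linarith
  then obtain x where x: "x \<in> R" "2 * card (C x) \<le> card R" using ab(1,2) by blast
  have "x \<in> C x" by (simp add: C_def)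
  hence "C x \<noteq> {}" by blast
  thus thesis by (rule that[OF _ CR[OF x(1)] x(2) Cbd[OF x(1)] Cconn])
qed

lemma disconnected_imp_deleted_boundary:
  assumes G: "regular_graph d G" and R: "R \<noteq> {}" "R \<subseteq> pverts G"
    and nc: "\<not> Digraph_Component.connected (with_proj G \<restriction> R)"
  shows "\<exists>k\<in>{1..card (pverts G) div 2}. \<exists>w\<in>walks G (2 * (k - 1)).
    card (set w) = k \<and> boundary G (set w) \<inter> R = {}"
proof -
  obtain U where U: "U \<noteq> {}" "U \<subseteq> R" "2 * card U \<le> card R" "boundary G U \<inter> R = {}"
    and conn: "\<And>A. A \<noteq> {} \<Longrightarrow> A \<subset> U \<Longrightarrow> \<exists>a\<in>A. \<exists>b\<in>U - A. (a, b) \<in> parcs G"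
    by (rule disconnected_imp_isolated_piece[OF G R nc]) (rule that)
  have UV: "U \<subseteq> pverts G" using U R by blast
  have "card R \<le> card (pverts G)" by (rule card_mono[OF regular_graphD(1)[OF G] R(2)])
  moreover have "card U > 0" using U(1) finite_subset[OF UV regular_graphD(1)[OF G]] by (simp add: card_gt_0_iff)
  ultimately have "card U \<in> {1..card (pverts G) div 2}" using U(3) by auto
  moreover obtain w where "w \<in> walks G (2 * (card U - 1))" "set w = U"
    using walk_covering_connected_set[OF G UV U(1) conn] by blast
  ultimately show ?thesis using U(4) by blast
qed

section \<open>The union bound\<close>

lemma prob_all_deleted:
  assumes fin: "finite V" and S: "S \<subseteq> V" and p: "0 \<le> p" "p \<le> 1"
  shows "measure_pmf.prob (Pi_pmf V False (\<lambda>_. bernoulli_pmf p)) {del. \<forall>v\<in>S. del v} = p ^ card S"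
proof -
  define B where "B = (\<lambda>v. if v \<in> S then {True} else UNIV)"
  have "{del. \<forall>v\<in>S. del v} = Pi V B" using S by (auto simp: B_def Pi_def)
  hence "measure_pmf.prob (Pi_pmf V False (\<lambda>_. bernoulli_pmf p)) {del. \<forall>v\<in>S. del v}
      = (\<Prod>v\<in>V. measure_pmf.prob (bernoulli_pmf p) (B v))"
    by (simp add: measure_Pi_pmf_Pi[OF fin])
  also have "\<dots> = (\<Prod>v\<in>V. if v \<in> S then p else 1)"
    by (intro prod.cong refl) (use p in \<open>simp add: B_def measure_pmf_single\<close>)
  also have "\<dots> = p ^ card S"
    using fin S by (simp add: prod.If_cases Int_absorb1)
  finally show ?thesis .
qed

text \<open>
  The term \<open>p ^ n\<close> is for the event that no vertex survives: the empty graph does not count as connected.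
\<close>

lemma disconnection_union_bound:
  assumes G: "regular_graph d G" and p: "0 \<le> p" "p \<le> 1"
  defines "n \<equiv> card (pverts G)"
  shows "1 - measure_pmf.prob (deletion_pmf G p) {H. Digraph_Component.connected H}
    \<le> p ^ n + (\<Sum>k=1..n div 2. \<Sum>w | w \<in> walks G (2 * (k - 1)) \<and> card (set w) = k.
                    p ^ card (boundary G (set w)))"
proof -
  let ?V = "pverts G"
  note GD = regular_graphD[OF G]
  define P where "P = Pi_pmf ?V False (\<lambda>_. bernoulli_pmf p)"
  define good where "good = {del. Digraph_Component.connected (with_proj G \<restriction> {v \<in> ?V. \<not> del v})}"
  define A where "A = (\<lambda>S. {del :: 'a \<Rightarrow> bool. \<forall>v\<in>S. del v})"
  define W where "W = (\<lambda>k. {w. w \<in> walks G (2 * (k - 1)) \<and> card (set w) = k})"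
  have finW: "finite (W k)" for k
    by (rule finite_subset[OF _ conjunct1[OF walks_count[OF G, of "2 * (k - 1)"]]]) (auto simp: W_def)
  have "measure_pmf.prob (deletion_pmf G p) {H. Digraph_Component.connected H} = measure_pmf.prob P good"
    by (simp add: deletion_pmf_def P_def good_def vimage_def)
  hence "1 - measure_pmf.prob (deletion_pmf G p) {H. Digraph_Component.connected H}
      = measure_pmf.prob P (- good)"
    using measure_pmf.prob_compl[of good P] by (simp add: Compl_eq_Diff_UNIV)
  also have "\<dots> \<le> measure_pmf.prob P (A ?V \<union> (\<Union>k\<in>{1..n div 2}. \<Union>w\<in>W k. A (boundary G (set w))))"
  proof (rule measure_pmf.finite_measure_mono)
    show "- good \<subseteq> A ?V \<union> (\<Union>k\<in>{1..n div 2}. \<Union>w\<in>W k. A (boundary G (set w)))"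
    proof
      fix del assume "del \<in> - good"
      hence nc: "\<not> Digraph_Component.connected (with_proj G \<restriction> {v \<in> ?V. \<not> del v})"
        by (simp add: good_def)
      show "del \<in> A ?V \<union> (\<Union>k\<in>{1..n div 2}. \<Union>w\<in>W k. A (boundary G (set w)))"
      proof (cases "{v \<in> ?V. \<not> del v} = {}")
        case True
        hence "del \<in> A ?V" by (auto simp: A_def)
        thus ?thesis by blast
      next
        case False
        have "{v \<in> ?V. \<not> del v} \<subseteq> ?V" by blast
        from disconnected_imp_deleted_boundary[OF G False this nc]
        obtain k w where kw: "k \<in> {1..n div 2}" "w \<in> W k"
          "boundary G (set w) \<inter> {v \<in> ?V. \<not> del v} = {}"
          unfolding n_def W_def by blast
        have "del \<in> A (boundary G (set w))"
          using kw(3) boundary_subset(1)[OF G, of "set w"] by (auto simp: A_def)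
        thus ?thesis using kw(1,2) by blast
      qed
    qed
  qed simp
  also have "\<dots> \<le> measure_pmf.prob P (A ?V)
      + measure_pmf.prob P (\<Union>k\<in>{1..n div 2}. \<Union>w\<in>W k. A (boundary G (set w)))"
    by (rule measure_Un_le) simp_all
  finally have "1 - measure_pmf.prob (deletion_pmf G p) {H. Digraph_Component.connected H}
    \<le> measure_pmf.prob P (A ?V)
      + measure_pmf.prob P (\<Union>k\<in>{1..n div 2}. \<Union>w\<in>W k. A (boundary G (set w)))" .
  moreover have "measure_pmf.prob P (A ?V) = p ^ n"
    unfolding P_def A_def n_def by (rule prob_all_deleted[OF GD(1) order_refl p])
  moreover have "measure_pmf.prob P (\<Union>k\<in>{1..n div 2}. \<Union>w\<in>W k. A (boundary G (set w)))
      \<le> (\<Sum>k=1..n div 2. \<Sum>w\<in>W k. p ^ card (boundary G (set w)))"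
  proof -
    have "measure_pmf.prob P (\<Union>k\<in>{1..n div 2}. \<Union>w\<in>W k. A (boundary G (set w)))
      \<le> (\<Sum>k=1..n div 2. measure_pmf.prob P (\<Union>w\<in>W k. A (boundary G (set w))))"
      by (rule measure_pmf.finite_measure_subadditive_finite) simp_all
    also have "\<dots> \<le> (\<Sum>k=1..n div 2. \<Sum>w\<in>W k. measure_pmf.prob P (A (boundary G (set w))))"
      by (intro sum_mono measure_pmf.finite_measure_subadditive_finite finW) simp_all
    also have "\<dots> = (\<Sum>k=1..n div 2. \<Sum>w\<in>W k. p ^ card (boundary G (set w)))"
      unfolding P_def A_def
      by (intro sum.cong refl prob_all_deleted[OF GD(1) boundary_subset(1)[OF G] p])
    finally show ?thesis .
  qed
  ultimately show ?thesis unfolding W_def by linarith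
qed

text \<open>
  Up to size \<open>K\<close> the boundary is bounded below by \<open>d\<close>, beyond \<open>K\<close> by \<open>c k\<close>. In the second range the
  terms of the sum over \<open>k\<close> are at most \<open>n q ^ k\<close> with \<open>q = d\<^sup>2 p powr c \<le> 1\<close>, hence at most \<open>n q ^ K\<close>; there are at most
  \<open>n\<close> of them, and the wasted factor \<open>n\<close> is compensated by the choice of \<open>K\<close>.
\<close>

lemma disconnection_prob_le:
  assumes G: "regular_graph d G" and d: "d \<ge> 1" and p: "0 < p" "p \<le> 1"
  defines "n \<equiv> card (pverts G)"
  assumes n: "n > 0" and q: "real d ^ 2 * p powr c \<le> 1"
    and exp1: "\<And>U. U \<subseteq> pverts G \<Longrightarrow> U \<noteq> {} \<Longrightarrow> 2 * card U \<le> n \<Longrightarrow> d \<le> card (boundary G U)"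
    and exp2: "\<And>U. U \<subseteq> pverts G \<Longrightarrow> 2 * card U \<le> n \<Longrightarrow> c * real (card U) \<le> real (card (boundary G U))"
  shows "1 - measure_pmf.prob (deletion_pmf G p) {H. Digraph_Component.connected H}
    \<le> p + real K * (real n * (real d ^ 2) ^ K * p ^ d) + real n ^ 2 * (real d ^ 2 * p powr c) ^ K"
proof -
  define D where "D = real d ^ 2"
  have D: "D \<ge> 1" using d by (simp add: D_def)
  define q where "q = D * p powr c"
  have q01: "0 \<le> q" "q \<le> 1" using q D by (auto simp: q_def D_def)
  define T where "T = real n * D ^ K * p ^ d"
  have T0: "T \<ge> 0" using D p by (simp add: T_def)
  define W where "W = (\<lambda>k. {w. w \<in> walks G (2 * (k - 1)) \<and> card (set w) = k})"
  have cardW: "real (card (W k)) \<le> real n * D ^ k" for k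
  proof -
    note wc = walks_count[OF G, of "2 * (k - 1)"]
    have "card (W k) \<le> card (walks G (2 * (k - 1)))"
      by (rule card_mono) (use wc in \<open>auto simp: W_def\<close>)
    also have "\<dots> \<le> n * d ^ (2 * (k - 1))" using wc by (simp add: n_def)
    finally have "real (card (W k)) \<le> real (n * d ^ (2 * (k - 1)))" by (rule of_nat_mono)
    also have "\<dots> = real n * D ^ (k - 1)" by (simp add: D_def power_mult)
    also have "\<dots> \<le> real n * D ^ k" using D by (intro mult_left_mono power_increasing) auto
    finally show ?thesis .
  qed
  have summand: "(\<Sum>w\<in>W k. p ^ card (boundary G (set w))) \<le> (if k \<le> K then T else 0) + real n * q ^ K"
    if k: "k \<in> {1..n div 2}" for k
  proof -
    have U: "set w \<subseteq> pverts G" "set w \<noteq> {}" "2 * card (set w) \<le> n" "card (set w) = k"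
      if "w \<in> W k" for w
      using that k by (auto simp: W_def walks_def)
    show ?thesis
    proof (cases "k \<le> K")
      case True
      have "(\<Sum>w\<in>W k. p ^ card (boundary G (set w))) \<le> (\<Sum>w\<in>W k. p ^ d)"
        using U exp1 p by (intro sum_mono power_decreasing) auto
      also have "\<dots> = real (card (W k)) * p ^ d" by simp
      also have "\<dots> \<le> real n * D ^ k * p ^ d" using cardW p by (intro mult_right_mono) auto
      also have "\<dots> \<le> T" unfolding T_def using D p True
        by (intro mult_right_mono mult_left_mono power_increasing) auto
      finally show ?thesis using True q01 by (simp add: add_increasing2)
    next
      case False
      have "(\<Sum>w\<in>W k. p ^ card (boundary G (set w))) \<le> (\<Sum>w\<in>W k. (p powr c) ^ k)"
      proof (rule sum_mono)
        fix w assume w: "w \<in> W k"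
        have "c * real k \<le> real (card (boundary G (set w)))" using exp2[of "set w"] U[OF w] by simp
        hence "p powr real (card (boundary G (set w))) \<le> p powr (c * real k)"
          using p by (intro powr_mono') auto
        thus "p ^ card (boundary G (set w)) \<le> (p powr c) ^ k"
          using p by (simp add: powr_realpow powr_powr flip: powr_realpow)
      qed
      also have "\<dots> = real (card (W k)) * (p powr c) ^ k" by simp
      also have "\<dots> \<le> real n * D ^ k * (p powr c) ^ k" using cardW p by (intro mult_right_mono) auto
      also have "\<dots> = real n * q ^ k" by (simp add: q_def power_mult_distrib)
      also have "\<dots> \<le> real n * q ^ K" using q01 False by (intro mult_left_mono power_decreasing) auto
      finally show ?thesis using False by simp
    qed
  qed
  have "(\<Sum>k=1..n div 2. \<Sum>w\<in>W k. p ^ card (boundary G (set w)))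
      \<le> (\<Sum>k=1..n div 2. (if k \<le> K then T else 0) + real n * q ^ K)"
    by (intro sum_mono summand)
  moreover have "\<dots> = real (card ({1..n div 2} \<inter> {k. k \<le> K})) * T + real (n div 2) * (real n * q ^ K)"
    by (simp add: sum.distrib sum.If_cases)
  moreover have "real (card ({1..n div 2} \<inter> {k. k \<le> K})) * T \<le> real K * T"
  proof -
    have "card ({1..n div 2} \<inter> {k. k \<le> K}) \<le> card {1..K}" by (rule card_mono) auto
    thus ?thesis using T0 by (intro mult_right_mono) auto
  qed
  moreover have "real (n div 2) * (real n * q ^ K) \<le> real n * (real n * q ^ K)"
    using q01 by (intro mult_right_mono) auto
  moreover have "p ^ n \<le> p" using power_decreasing[of 1 n p] n p by simp
  moreover have "1 - measure_pmf.prob (deletion_pmf G p) {H. Digraph_Component.connected H}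
      \<le> p ^ n + (\<Sum>k=1..n div 2. \<Sum>w\<in>W k. p ^ card (boundary G (set w)))"
    using disconnection_union_bound[OF G, of p] p unfolding n_def W_def by simp
  ultimately have "1 - measure_pmf.prob (deletion_pmf G p) {H. Digraph_Component.connected H}
      \<le> p + (real K * T + real n * (real n * q ^ K))" by linarith
  thus ?thesis unfolding T_def q_def D_def by (simp add: power2_eq_square mult.assoc)
qed

text \<open>
  With \<open>p = n powr (- \<alpha>)\<close> the three terms of \<open>disconnection_prob_le\<close> are constant multiples of powers
  of \<open>n\<close>, with the exponents \<open>- \<alpha>\<close>, \<open>1 - \<alpha> d\<close> and \<open>2 - \<alpha> c K\<close>.
\<close>

lemma union_bound_tends_to_zero:
  fixes \<alpha> c D :: real and d K :: nat
  assumes \<alpha>: "\<alpha> > 0" "\<alpha> * real d > 1" "\<alpha> * c * real K > 2"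
  shows "((\<lambda>x. x powr (- \<alpha>) + real K * (x * D ^ K * (x powr (- \<alpha>)) ^ d)
            + x ^ 2 * (D * (x powr (- \<alpha>)) powr c) ^ K) \<longlongrightarrow> 0) at_top"
proof -
  have lim: "((\<lambda>x :: real. x powr s) \<longlongrightarrow> 0) at_top" if "s < 0" for s
    by (rule tendsto_neg_powr[OF that filterlim_ident])
  have "((\<lambda>x. x powr (- \<alpha>) + real K * D ^ K * x powr (1 - \<alpha> * real d)
      + D ^ K * x powr (2 - \<alpha> * c * real K)) \<longlongrightarrow> 0 + real K * D ^ K * 0 + D ^ K * 0) at_top"
    using \<alpha> by (intro tendsto_intros lim) auto
  moreover have "\<forall>\<^sub>F x in at_top. x powr (- \<alpha>) + real K * D ^ K * x powr (1 - \<alpha> * real d)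
      + D ^ K * x powr (2 - \<alpha> * c * real K)
    = x powr (- \<alpha>) + real K * (x * D ^ K * (x powr (- \<alpha>)) ^ d)
      + x ^ 2 * (D * (x powr (- \<alpha>)) powr c) ^ K"
    using eventually_gt_at_top[of 0]
  proof eventually_elim
    case (elim x)
    have "(x powr (- \<alpha>)) ^ d = x powr (- (\<alpha> * real d))"
      using elim by (simp add: powr_powr flip: powr_realpow)
    moreover have "((x powr (- \<alpha>)) powr c) ^ K = x powr (- (\<alpha> * c * real K))"
      using elim by (simp add: powr_powr flip: powr_realpow)
    moreover have "x * x powr (- (\<alpha> * real d)) = x powr (1 - \<alpha> * real d)"
      using elim powr_add[of x 1 "- (\<alpha> * real d)"] by simp
    moreover have "x ^ 2 * x powr (- (\<alpha> * c * real K)) = x powr (2 - \<alpha> * c * real K)"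
      using elim powr_add[of x 2 "- (\<alpha> * c * real K)"] by simp
    ultimately show ?case by (simp add: power_mult_distrib mult.assoc mult.left_commute)
  qed
  ultimately show ?thesis by (simp add: tendsto_cong)
qed

theorem proposition3p5:
  fixes d :: nat and \<alpha> :: real
    and n :: "nat \<Rightarrow> nat" and l :: "nat \<Rightarrow> real"
    and G :: "nat \<Rightarrow> 'a pair_pre_digraph"
  assumes "d \<ge> 3"
    and "\<alpha> > 1 / real d"
    and "filterlim n at_top sequentially"
    and "\<And>k. ndlambda_graph (n k) d (l k) (G k)"
    and "\<And>k. l k \<le> 2 * sqrt (real d - 1) + 1 / 40"
    and "\<And>k. max_density (G k) (real d + 29) \<le> 1"
  shows "(\<lambda>k. measure_pmf.prob (deletion_pmf (G k) (real (n k) powr (- \<alpha>)))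
                 {H. Digraph_Component.connected H}) \<longlonglongrightarrow> 1"
proof -
  define l0 where "l0 = 2 * sqrt (real d - 1) + 1 / 40"
  define c where "c = (real d - l0) / (2 * real d)"
  have l0: "0 \<le> l0" "l0 < real d" using ramanujan_gap(1)[OF assms(1)] assms(1) by (auto simp: l0_def)
  have c: "c > 0" using l0 by (simp add: c_def)
  have "1 / real d > 0" using assms(1) by simp
  hence \<alpha>: "\<alpha> > 0" using assms(2) by linarith
  have \<alpha>d: "\<alpha> * real d > 1" using assms(1,2) by (simp add: field_simps)
  \<comment> \<open>Sets of more than \<open>K\<close> vertices have a boundary so large that linear expansion pays for the
    number of walks and for the sum over all sizes.\<close>
  obtain K where "2 / (\<alpha> * c) < real K" using reals_Archimedean2 by blast
  hence K: "\<alpha> * c * real K > 2" using \<alpha> c by (simp add: field_simps)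
  define f where "f = (\<lambda>x. x powr (- \<alpha>) + real K * (x * (real d ^ 2) ^ K * (x powr (- \<alpha>)) ^ d)
            + x ^ 2 * (real d ^ 2 * (x powr (- \<alpha>)) powr c) ^ K)"
  define P where "P = (\<lambda>k. measure_pmf.prob (deletion_pmf (G k) (real (n k) powr (- \<alpha>)))
                 {H. Digraph_Component.connected H})"
  have n_top: "filterlim (\<lambda>k. real (n k)) at_top sequentially"
    by (rule filterlim_compose[OF filterlim_real_sequentially assms(3)])
  have "(f \<longlongrightarrow> 0) at_top"
    unfolding f_def by (rule union_bound_tends_to_zero[OF \<alpha> \<alpha>d K])
  hence f0: "(\<lambda>k. f (real (n k))) \<longlonglongrightarrow> 0" by (rule filterlim_compose[OF _ n_top])
  have "((\<lambda>x. real d ^ 2 * x powr (- (\<alpha> * c))) \<longlongrightarrow> real d ^ 2 * 0) at_top"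
    by (intro tendsto_mult tendsto_const tendsto_neg_powr filterlim_ident) (use \<alpha> c in simp)
  hence "\<forall>\<^sub>F x in at_top. real d ^ 2 * x powr (- (\<alpha> * c)) < 1"
    by (rule order_tendstoD(2)) simp
  hence ev1: "\<forall>\<^sub>F k in sequentially. real d ^ 2 * real (n k) powr (- (\<alpha> * c)) < 1"
    using n_top by (rule eventually_compose_filterlim)
  have ev2: "\<forall>\<^sub>F k in sequentially. 100 * real d * (real d / c + real d)\<^sup>2 \<le> real (n k)"
    using n_top unfolding filterlim_at_top by blast
  have ev3: "\<forall>\<^sub>F k in sequentially. 2 \<le> real (n k)"
    using n_top unfolding filterlim_at_top by blast
  have bound: "\<forall>\<^sub>F k in sequentially. 1 - f (real (n k)) \<le> P k"
    using ev1 ev2 ev3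
  proof eventually_elim
    case (elim k)
    define p where "p = real (n k) powr (- \<alpha>)"
    have G: "regular_graph d (G k)" and nk: "card (pverts (G k)) = n k" and lk: "second_eigenvalue (G k) \<le> l0"
      using assms(4,5)[of k] by (auto simp: ndlambda_graph_def l0_def)
    have "real (n k) powr (- \<alpha>) \<le> real (n k) powr 0" using elim \<alpha> by (intro powr_mono) auto
    hence p: "0 < p" "p \<le> 1" using elim by (auto simp: p_def)
    have "1 - P k \<le> p + real K * (real (card (pverts (G k))) * (real d ^ 2) ^ K * p ^ d)
        + real (card (pverts (G k))) ^ 2 * (real d ^ 2 * p powr c) ^ K"
      unfolding P_def p_def[symmetric]
    proof (rule disconnection_prob_le[OF G _ p])
      show "real d ^ 2 * p powr c \<le> 1" using elim by (simp add: p_def powr_powr)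
      fix U assume U: "U \<subseteq> pverts (G k)" "2 * card U \<le> card (pverts (G k))"
      show "c * real (card U) \<le> real (card (boundary (G k) U))"
        using boundary_linear[OF G _ lk l0 U] elim by (simp add: c_def nk)
      show "d \<le> card (boundary (G k) U)" if "U \<noteq> {}"
        using boundary_ge_degree[OF G assms(1) assms(6)[of k] _ U(1) that U(2)] lk elim
        by (simp add: l0_def c_def nk)
    qed (use elim assms(1) nk in auto)
    thus ?case by (simp add: f_def p_def nk)
  qed
  have "P \<longlonglongrightarrow> 1"
  proof (rule tendsto_sandwich[OF bound])
    show "\<forall>\<^sub>F k in sequentially. P k \<le> 1" by (simp add: P_def)
    show "(\<lambda>k. 1 - f (real (n k))) \<longlonglongrightarrow> 1" using tendsto_diff[OF tendsto_const f0, of 1] by simp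
  qed simp
  thus ?thesis unfolding P_def .
qed

end
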